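(* Let $f\in\{0,1\}^n$. Suppose that at least one of the four words $f$, $f^{rev}$, $\overline{f}$, $\overline{f}^{\,rev}$ satisfies at least one of the following conditions. Then $f$ is tilde-non-isometric. (1) It has a $2$-tilde-error overlap whose error positions are not adjacent. (2) It has a $2$-tilde-error overlap of type SS with adjacent error positions. (3) There exist words $w_1,w_2,w_3,w_4$ with $w_1$ nonempty such that it equals $w_2\,101\,w_3w_4=w_1w_2\,010\,w_3$. This is a $2$-tilde-error overlap with error block $101$, of type SR or RS. (4) There exist words $x,y,z$ such that it equals $x\,1001\,z=y\,x\,011$. (5) It begins with $110$ and ends with $100$. In this case $\mathrm{pre}_2=11$ and $\mathrm{suf}_2=00$, giving a $2$-tilde-error overlap of type RR.
   Context: Words are over $\{0,1\}$. $f^{rev}$ is the reverse of $f$ and $\overline{f}$ its complement (each symbol flipped). For $w$ of length $n$: $\mathrm{pre}_l(w)=w[1..l]$ and $\mathrm{suf}_l(w)=w[n-l+1..n]$. A word is $f$-free if it does not contain $f$ as a factor. Operations: the replacement $R_i$ flips the symbol at position $i$ and modifies position $i$. The swap $S_i$ is defined when $w[i]\ne w[i+1]$, exchanges these two symbols, and modifies positions $i,i+1$. $\mathrm{dist}_\sim(u,v)$ is the minimum number of replacements and swaps transforming $u$ into the equal-length word $v$. A tilde-transformation from $u$ to $v$ is a sequence of words from $u$ to $v$, each obtained from the previous by one operation. It is minimal if it uses exactly $\mathrm{dist}_\sim(u,v)$ operations and each position is modified by at most one operation. $f$ is tilde-isometric if, for every $m>n$ and all $f$-free $u,v\in\{0,1\}^m$,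 there is a minimal tilde-transformation from $u$ to $v$ all of whose words are $f$-free. Otherwise it is tilde-non-isometric. $f$ has a $2$-tilde-error overlap of length $l$ (with $1\le l\le n-1$) if $\mathrm{dist}_\sim(\mathrm{pre}_l(f),\mathrm{suf}_l(f))=2$. Fix a minimal tilde-transformation from $\mathrm{pre}_l(f)$ to $\mathrm{suf}_l(f)$. Its two operations $O_i\in\{R_i,S_i\}$ and $O_j\in\{R_j,S_j\}$ act at positions $i<j$ (the error positions). The type is RR, SR, RS or SS according to whether $(O_i,O_j)$ is (replacement, replacement), (swap, replacement), (replacement, swap) or (swap, swap). The error positions are adjacent if $j=i+1$ when $O_i$ is a replacement (types RR, RS), and if $j=i+2$ when $O_i$ is a swap (types SR, SS). *)

theory Defs
  imports Main
begin

text \<open>Binary words are bool lists (True = 1, False = 0). Positions are 0-based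
  list indices (the paper uses 1-based positions; all conditions used below are
  invariant under this shift).\<close>

datatype top = Rep nat | Swp nat

fun opos :: "top \<Rightarrow> nat" where
  "opos (Rep i) = i" | "opos (Swp i) = i"

fun is_swap :: "top \<Rightarrow> bool" where
  "is_swap (Rep i) = False" | "is_swap (Swp i) = True"

fun modified :: "top \<Rightarrow> nat set" where
  "modified (Rep i) = {i}" | "modified (Swp i) = {i, Suc i}"

fun op_ok :: "top \<Rightarrow> bool list \<Rightarrow> bool" where
  "op_ok (Rep i) w = (i < length w)"
| "op_ok (Swp i) w = (Suc i < length w \<and> w ! i \<noteq> w ! Suc i)"

fun apply_op :: "top \<Rightarrow> bool list \<Rightarrow> bool list" where
  "apply_op (Rep i) w = w[i := \<not> w ! i]"
| "apply_op (Swp i) w = w[i := w ! Suc i, Suc i := w ! i]"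

fun ops_valid :: "bool list \<Rightarrow> top list \<Rightarrow> bool" where
  "ops_valid w [] = True"
| "ops_valid w (o1 # os) = (op_ok o1 w \<and> ops_valid (apply_op o1 w) os)"

fun trace :: "bool list \<Rightarrow> top list \<Rightarrow> bool list list" where
  "trace w [] = [w]"
| "trace w (o1 # os) = w # trace (apply_op o1 w) os"

definition transforms :: "bool list \<Rightarrow> top list \<Rightarrow> bool list \<Rightarrow> bool" where
  "transforms u ops v \<longleftrightarrow> ops_valid u ops \<and> last (trace u ops) = v"

definition tdist :: "bool list \<Rightarrow> bool list \<Rightarrow> nat" where
  "tdist u v = (LEAST k. \<exists>ops. transforms u ops v \<and> length ops = k)"

definition minimal_trans :: "bool list \<Rightarrow> top list \<Rightarrow> bool list \<Rightarrow> bool" where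
  "minimal_trans u ops v \<longleftrightarrow> transforms u ops v \<and> length ops = tdist u v \<and>
     (\<forall>a < length ops. \<forall>b < length ops. a \<noteq> b \<longrightarrow> modified (ops ! a) \<inter> modified (ops ! b) = {})"

definition free :: "bool list \<Rightarrow> bool list \<Rightarrow> bool" where
  "free f w \<longleftrightarrow> \<not> (\<exists>p s. w = p @ f @ s)"

definition tilde_isometric :: "bool list \<Rightarrow> bool" where
  "tilde_isometric f \<longleftrightarrow>
     (\<forall>m > length f. \<forall>u v. length u = m \<and> length v = m \<and> free f u \<and> free f v \<longrightarrow>
        (\<exists>ops. minimal_trans u ops v \<and> (\<forall>x \<in> set (trace u ops). free f x)))"

definition pre :: "nat \<Rightarrow> bool list \<Rightarrow> bool list" where
  "pre l w = take l w"

definition suf :: "nat \<Rightarrow> bool list \<Rightarrow> bool list" where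
  "suf l w = drop (length w - l) w"

definition two_err_overlap :: "bool list \<Rightarrow> nat \<Rightarrow> bool" where
  "two_err_overlap f l \<longleftrightarrow> 1 \<le> l \<and> l \<le> length f - 1 \<and> tdist (pre l f) (suf l f) = 2"

definition err_overlap_ops :: "bool list \<Rightarrow> nat \<Rightarrow> top \<Rightarrow> top \<Rightarrow> bool" where
  "err_overlap_ops f l a b \<longleftrightarrow> two_err_overlap f l \<and> opos a < opos b \<and>
     (minimal_trans (pre l f) [a, b] (suf l f) \<or> minimal_trans (pre l f) [b, a] (suf l f))"

fun adjacent :: "top \<Rightarrow> top \<Rightarrow> bool" where
  "adjacent (Rep i) b = (opos b = i + 1)"
| "adjacent (Swp i) b = (opos b = i + 2)"

definition cond1 :: "bool list \<Rightarrow> bool" where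
  "cond1 g \<longleftrightarrow> (\<exists>l a b. err_overlap_ops g l a b \<and> \<not> adjacent a b)"

definition cond2 :: "bool list \<Rightarrow> bool" where
  "cond2 g \<longleftrightarrow> (\<exists>l a b. err_overlap_ops g l a b \<and> is_swap a \<and> is_swap b \<and> adjacent a b)"

definition cond3 :: "bool list \<Rightarrow> bool" where
  "cond3 g \<longleftrightarrow> (\<exists>w1 w2 w3 w4. w1 \<noteq> [] \<and> g = w2 @ [True, False, True] @ w3 @ w4 \<and>
                               g = w1 @ w2 @ [False, True, False] @ w3)"

definition cond4 :: "bool list \<Rightarrow> bool" where
  "cond4 g \<longleftrightarrow> (\<exists>x y z. g = x @ [True, False, False, True] @ z \<and> g = y @ x @ [False, True, True])"

definition cond5 :: "bool list \<Rightarrow> bool" where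
  "cond5 g \<longleftrightarrow> (\<exists>p s. g = [True, True, False] @ p \<and> g = s @ [True, False, False])"

end

theory Submission
  imports Defs
begin

text \<open>
  Operations with disjoint supports flip exactly the symbols they modify, so a minimal transformation
  from \<open>u\<close> to \<open>v\<close> tiles the set of positions where \<open>u\<close> and \<open>v\<close> differ. It therefore suffices to find
  \<open>f\<close>-free words \<open>u\<close>, \<open>v\<close> such that every tile occurring in a tiling of minimal size, flipped in \<open>u\<close>,
  creates an occurrence of \<open>f\<close>.

  Place \<open>f\<close> at offsets \<open>0\<close> and \<open>r\<close>; the copies clash on two tiles \<open>A\<close> and \<open>B\<close>. The word \<open>u\<close> follows the
  second copy on \<open>A\<close> and the first on \<open>B\<close>, the word \<open>v\<close> the other way round: flipping \<open>A\<close> (resp. \<open>B\<close>)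
  in \<open>u\<close> restores the first (resp. second) copy. If \<open>f\<close> occurs in \<open>u\<close> or \<open>v\<close> at an offset \<open>k\<close>, then \<open>f\<close> has
  a one-tile error at shift \<open>k\<close> and at shift \<open>r - k\<close>, and composing the two shifts in either order
  forces \<open>r = 2 k\<close> and \<open>B = A + k\<close>. In that exceptional case \<open>f\<close> is \<open>k\<close>-periodic up to a single tile, and
  either a longer multiple of \<open>k\<close> yields an overlap that is not exceptional, or a word built from copies
  of \<open>f\<close> at offsets \<open>0\<close>, \<open>2 k\<close> and \<open>3 k\<close> needs three operations, each of which creates \<open>f\<close> when it is
  applied first. Conditions (4) and (5) are handled by the same scheme with the block \<open>1010\<close> changed to
  \<open>0101\<close> by two swaps, one of which reaches beyond the overlap.
\<close>

section \<open>Disjoint operations as flips\<close>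

text \<open>Boolean inequality acts as exclusive or. Passing from lists of operations to sets of
  positions makes the order of disjoint operations irrelevant.\<close>

definition flips :: "nat set \<Rightarrow> bool list \<Rightarrow> bool list" where
  "flips S w = map (\<lambda>i. w ! i \<noteq> (i \<in> S)) [0..<length w]"

lemma length_flips [simp]: "length (flips S w) = length w"
  by (simp add: flips_def)

lemma nth_flips [simp]: "i < length w \<Longrightarrow> flips S w ! i = (w ! i \<noteq> (i \<in> S))"
  by (simp add: flips_def)

lemma flips_empty [simp]: "flips {} w = w"
  by (simp add: list_eq_iff_nth_eq)

lemma flips_flips: "S \<inter> T = {} \<Longrightarrow> flips T (flips S w) = flips (S \<union> T) w"
  by (auto simp: list_eq_iff_nth_eq)

lemma flips_eq_iff:
  assumes "S \<subseteq> {..<length w}" "T \<subseteq> {..<length w}"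
  shows "flips S w = flips T w \<longleftrightarrow> S = T"
proof
  assume eq: "flips S w = flips T w"
  have "i \<in> S \<longleftrightarrow> i \<in> T" if "i < length w" for i
    using arg_cong[OF eq, of "\<lambda>z. z ! i"] that by auto
  with assms show "S = T" by blast
qed simp

text \<open>A legal swap meets two different symbols, so exchanging them is the same as flipping
  both.\<close>

lemma apply_op_eq_flips: "op_ok a w \<Longrightarrow> apply_op a w = flips (modified a) w"
  by (cases a) (auto simp: list_eq_iff_nth_eq nth_list_update)

lemma op_ok_flips: "modified a \<inter> S = {} \<Longrightarrow> op_ok a (flips S w) = op_ok a w"
  by (cases a) auto

lemma modified_subset: "op_ok a w \<Longrightarrow> modified a \<subseteq> {..<length w}"
  by (cases a) auto

abbreviation disjoint_ops :: "top list \<Rightarrow> bool" where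
  "disjoint_ops \<equiv> sorted_wrt (\<lambda>a b. modified a \<inter> modified b = {})"

lemma trace_not_Nil [simp]: "trace w os \<noteq> []"
  by (cases os) auto

lemma start_in_trace: "w \<in> set (trace w os)"
  by (cases os) auto

text \<open>Flips outside the support of an operation do not affect its legality, so all of them can
  be tested on the initial word.\<close>

lemma ops_valid_disjoint_ops:
  "disjoint_ops os \<Longrightarrow> ops_valid w os \<longleftrightarrow> (\<forall>a\<in>set os. op_ok a w)"
proof (induction os arbitrary: w)
  case (Cons a os)
  have "op_ok c (flips (modified a) w) = op_ok c w" if "c \<in> set os" for c
    using Cons.prems that by (intro op_ok_flips) auto
  with Cons show ?case by (auto simp: apply_op_eq_flips)
qed simp

lemma last_trace_disjoint_ops:
  "disjoint_ops os \<Longrightarrow> ops_valid w os \<Longrightarrow> last (trace w os) = flips (\<Union>(modified ` set os)) w"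
proof (induction os arbitrary: w)
  case (Cons a os)
  have "modified a \<inter> \<Union>(modified ` set os) = {}" using Cons.prems by auto
  with Cons show ?case by (auto simp: apply_op_eq_flips flips_flips)
qed simp

section \<open>A criterion for non-isometry\<close>

lemma tdist_le: "transforms u os v \<Longrightarrow> tdist u v \<le> length os"
  unfolding tdist_def by (rule Least_le) blast

lemma minimal_trans_disjoint_ops: "minimal_trans u os v \<Longrightarrow> disjoint_ops os"
  by (auto simp: minimal_trans_def sorted_wrt_iff_nth_less)

text \<open>The list \<open>ts\<close> bounds the distance from above, so every minimal
  transformation is a tiling of \<open>D\<close> by at most \<open>length ts\<close> legal
  operations. By \<open>key\<close>, whichever tile comes first already creates
  \<open>f\<close>.\<close>

lemma not_tilde_isometricI:
  assumes free: "free f u" "free f (flips D u)"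
    and len: "length f < length u"
    and D: "D \<noteq> {}"
    and ts: "disjoint_ops ts" "\<forall>a\<in>set ts. op_ok a u" "\<Union>(modified ` set ts) = D"
    and key: "\<And>os a. disjoint_ops os \<Longrightarrow> \<forall>a\<in>set os. op_ok a u \<Longrightarrow> \<Union>(modified ` set os) = D
                \<Longrightarrow> length os \<le> length ts \<Longrightarrow> a \<in> set os \<Longrightarrow> \<not> free f (flips (modified a) u)"
  shows "\<not> tilde_isometric f"
proof
  assume "tilde_isometric f"
  then obtain os where os: "minimal_trans u os (flips D u)" "\<forall>x\<in>set (trace u os). free f x"
    using free len unfolding tilde_isometric_def by (metis length_flips)
  have disj: "disjoint_ops os" using os(1) by (rule minimal_trans_disjoint_ops)
  have "transforms u ts (flips D u)"
    using ts by (simp add: transforms_def ops_valid_disjoint_ops last_trace_disjoint_ops)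
  then have le: "length os \<le> length ts"
    using os(1) tdist_le by (simp add: minimal_trans_def)
  have val: "ops_valid u os" and last: "last (trace u os) = flips D u"
    using os(1) by (auto simp: minimal_trans_def transforms_def)
  have ok: "\<forall>a\<in>set os. op_ok a u" using val ops_valid_disjoint_ops[OF disj] by simp
  have "D \<subseteq> {..<length u}" "\<Union>(modified ` set os) \<subseteq> {..<length u}"
    using ts ok modified_subset by blast+
  then have eqD: "\<Union>(modified ` set os) = D"
    using last last_trace_disjoint_ops[OF disj val] flips_eq_iff by metis
  then obtain a os' where cons: "os = a # os'" using D by (cases os) auto
  have "free f (apply_op a u)" using os(2) cons start_in_trace by auto
  then have "free f (flips (modified a) u)" using ok cons by (simp add: apply_op_eq_flips)
  then show False using key[OF disj ok eqD le] cons by simp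
qed

section \<open>Merging two copies of a word\<close>

lemma not_free_iff:
  "\<not> free f w \<longleftrightarrow> (\<exists>k. k + length f \<le> length w \<and> (\<forall>x<length f. w ! (k + x) = f ! x))"
proof
  assume "\<not> free f w"
  then obtain p s where "w = p @ f @ s" by (auto simp: free_def)
  then show "\<exists>k. k + length f \<le> length w \<and> (\<forall>x<length f. w ! (k + x) = f ! x)"
    by (intro exI[of _ "length p"]) (auto simp: nth_append)
next
  assume "\<exists>k. k + length f \<le> length w \<and> (\<forall>x<length f. w ! (k + x) = f ! x)"
  then obtain k where k: "k + length f \<le> length w" "\<forall>x<length f. w ! (k + x) = f ! x" by blast
  have "take (length f) (drop k w) = f" using k by (auto simp: list_eq_iff_nth_eq)
  then have "w = take k w @ f @ drop (length f) (drop k w)"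
    by (metis append_take_drop_id)
  then show "\<not> free f w" by (auto simp: free_def)
qed

text \<open>The word of length \<open>length f + r\<close> that differs from the copy of \<open>f\<close> at offset \<open>0\<close> exactly on \<open>P\<close>
  and, when the clashes of the two copies are \<open>P\<close> and \<open>Q\<close>, from the copy at offset \<open>r\<close> exactly on \<open>Q\<close>.\<close>

definition merge :: "bool list \<Rightarrow> nat \<Rightarrow> nat set \<Rightarrow> nat set \<Rightarrow> bool list" where
  "merge f r P Q = map (\<lambda>x. if x < length f then f ! x \<noteq> (x \<in> P) else f ! (x - r) \<noteq> (x \<in> Q))
     [0..<length f + r]"

lemma length_merge [simp]: "length (merge f r P Q) = length f + r"
  by (simp add: merge_def)

lemma nth_merge_left: "x < length f \<Longrightarrow> merge f r P Q ! x = (f ! x \<noteq> (x \<in> P))"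
  by (simp add: merge_def)

lemma nth_merge_right:
  assumes "\<forall>y\<in>{r..<length f}. (f ! y \<noteq> f ! (y - r)) \<longleftrightarrow> (y \<in> P) \<noteq> (y \<in> Q)"
    and "r \<le> y" "y < length f + r"
  shows "merge f r P Q ! y = (f ! (y - r) \<noteq> (y \<in> Q))"
  using bspec[OF assms(1), of y] assms(2,3) by (auto simp: merge_def)

text \<open>An occurrence at offset \<open>k\<close> is compared with the first copy at shift
  \<open>k\<close> and with the second at shift \<open>r - k\<close>. The third conjunct goes from
  \<open>y - r\<close> to \<open>y\<close> directly and through \<open>y - r + k\<close>; equating
  the results eliminates the symbols of \<open>f\<close> and leaves a condition on positions
  only.\<close>

lemma occurs_in_merge:
  assumes diff: "\<forall>y\<in>{r..<length f}. (f ! y \<noteq> f ! (y - r)) \<longleftrightarrow> (y \<in> P) \<noteq> (y \<in> Q)"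
    and "\<not> free f (merge f r P Q)"
  shows "\<exists>k. k \<le> r \<and>
    (\<forall>x. x + k < length f \<longrightarrow> (f ! x = f ! (x + k) \<longleftrightarrow> x + k \<notin> P)) \<and>
    (\<forall>x. x + (r - k) < length f \<longrightarrow> (f ! x = f ! (x + (r - k)) \<longleftrightarrow> x + r \<notin> Q)) \<and>
    (\<forall>y. r \<le> y \<and> y < length f \<longrightarrow>
      (((y \<in> P) = (y \<in> Q)) \<longleftrightarrow> ((y + k - r \<in> P) = (y + k \<in> Q))))"
proof -
  obtain k where k: "k \<le> r" and occ: "\<And>x. x < length f \<Longrightarrow> merge f r P Q ! (k + x) = f ! x"
    using assms(2) by (auto simp: not_free_iff)
  have 1: "f ! x = f ! (x + k) \<longleftrightarrow> x + k \<notin> P" if "x + k < length f" for x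
    using occ[of x] that nth_merge_left[of "x + k" f r P Q] by (auto simp: add.commute)
  have 2: "f ! x = f ! (x + (r - k)) \<longleftrightarrow> x + r \<notin> Q" if "x + (r - k) < length f" for x
    using occ[of "x + (r - k)"] that k nth_merge_right[of r f P Q "x + r", OF diff]
    by (auto simp: add.commute)
  have 3: "((y \<in> P) = (y \<in> Q)) \<longleftrightarrow> ((y + k - r \<in> P) = (y + k \<in> Q))"
    if "r \<le> y \<and> y < length f" for y
  proof -
    have "y - r + k < length f" "y - r + k + (r - k) = y" "y - r + k + r = y + k" "y - r + k = y + k - r"
      using that k by auto
    then show ?thesis using 1[of "y - r"] 2[of "y - r + k"] bspec[OF diff, of y] that
      by (metis atLeastLessThan_iff)
  qed
  show ?thesis using k 1 2 3 by blast
qed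

lemma flips_merge:
  assumes "A \<inter> B = {}"
  shows "flips (A \<union> B) (merge f r A B) = merge f r B A"
proof (rule nth_equalityI)
  fix x assume "x < length (flips (A \<union> B) (merge f r A B))"
  then show "flips (A \<union> B) (merge f r A B) ! x = merge f r B A ! x"
    using assms by (cases "x \<in> A"; cases "x \<in> B") (auto simp: merge_def)
qed simp

lemma not_free_flips_merge_left: "\<not> free f (flips P (merge f r P Q))"
  unfolding not_free_iff by (rule exI[of _ 0]) (auto simp: nth_merge_left)

lemma not_free_flips_merge_right:
  assumes "\<forall>y\<in>{r..<length f}. (f ! y \<noteq> f ! (y - r)) \<longleftrightarrow> (y \<in> P) \<noteq> (y \<in> Q)"
  shows "\<not> free f (flips Q (merge f r P Q))"
  unfolding not_free_iff
proof (intro exI[of _ r] conjI allI impI)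
  fix x assume x: "x < length f"
  have "merge f r P Q ! (r + x) = (f ! x \<noteq> (r + x \<in> Q))"
    using nth_merge_right[of r f P Q "r + x", OF assms] x by simp
  then show "flips Q (merge f r P Q) ! (r + x) = f ! x" using x by auto
qed simp

text \<open>Flipping one support completes the copy at offset 0, flipping the other the copy at
  offset \<open>r\<close>. The criterion then only asks that no other tile can occur, which is
  \<open>uniq\<close>.\<close>

lemma merge_pair_not_tilde_isometric:
  assumes diff: "\<forall>y\<in>{r..<length f}.
      (f ! y \<noteq> f ! (y - r)) \<longleftrightarrow> (y \<in> modified oa) \<noteq> (y \<in> modified ob)"
    and "0 < r"
    and disj: "modified oa \<inter> modified ob = {}"
    and ok: "op_ok oa (merge f r (modified oa) (modified ob))"
      "op_ok ob (merge f r (modified oa) (modified ob))"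
    and free: "free f (merge f r (modified oa) (modified ob))"
      "free f (merge f r (modified ob) (modified oa))"
    and uniq: "\<And>os a. disjoint_ops os \<Longrightarrow>
      \<forall>a\<in>set os. op_ok a (merge f r (modified oa) (modified ob)) \<Longrightarrow>
      \<Union>(modified ` set os) = modified oa \<union> modified ob \<Longrightarrow> length os \<le> 2 \<Longrightarrow> a \<in> set os \<Longrightarrow>
      modified a = modified oa \<or> modified a = modified ob"
  shows "\<not> tilde_isometric f"
proof (rule not_tilde_isometricI[where u = "merge f r (modified oa) (modified ob)"
      and D = "modified oa \<union> modified ob" and ts = "[oa, ob]"])
  show "free f (flips (modified oa \<union> modified ob) (merge f r (modified oa) (modified ob)))"
    using free disj by (simp add: flips_merge)
  show "modified oa \<union> modified ob \<noteq> {}" by (cases oa) auto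
  fix os a
  assume "disjoint_ops os" "\<forall>a\<in>set os. op_ok a (merge f r (modified oa) (modified ob))"
    "\<Union>(modified ` set os) = modified oa \<union> modified ob" "length os \<le> length [oa, ob]" "a \<in> set os"
  then have "modified a = modified oa \<or> modified a = modified ob" using uniq[of os a] by simp
  then show "\<not> free f (flips (modified a) (merge f r (modified oa) (modified ob)))"
  proof
    assume "modified a = modified oa"
    then show ?thesis by (simp add: not_free_flips_merge_left)
  next
    assume "modified a = modified ob"
    then show ?thesis using not_free_flips_merge_right[of r f, OF diff] by simp
  qed
qed (use \<open>0 < r\<close> disj ok free(1) in simp_all)

section \<open>Uniqueness of small tilings\<close>

lemma modified_eq_interval:
  "modified x = {opos x..<opos x + card (modified x)}" "card (modified x) = 1 \<or> card (modified x) = 2"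
  by (cases x; auto)+

lemma modified_swap_iff: "card (modified x) = 2 \<longleftrightarrow> x = Swp (opos x)"
  by (cases x) auto

lemma disjoint_opsD:
  assumes "disjoint_ops os" "x \<in> set os" "y \<in> set os" "x \<noteq> y"
  shows "modified x \<inter> modified y = {}"
  using assms by (induction os) auto

text \<open>The leftmost position forces \<open>i = a\<close>. After that the only rival tiling cuts
  a run of three as 1+2 instead of 2+1, or conversely. \<open>sep\<close> excludes it, and also two
  touching singletons, which one swap could cover.\<close>

lemma two_intervals_tiling_less:
  fixes a b i j p q s t :: nat
  assumes m: "\<And>z. i \<le> z \<and> z < i + s \<or> j \<le> z \<and> z < j + t \<longleftrightarrow>
      a \<le> z \<and> z < a + p \<or> b \<le> z \<and> z < b + q"
    and d: "i + s \<le> j"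
    and pq: "p = 1 \<or> p = 2" "q = 1 \<or> q = 2" "s = 1 \<or> s = 2" "t = 1 \<or> t = 2" "a + p \<le> b"
    and sep: "a + p < b \<or> p = 2 \<and> q = 2 \<or> p = 2 \<and> q = 1 \<and> (t = 2 \<longrightarrow> j \<noteq> a + 1)"
  shows "i = a \<and> s = p \<and> j = b \<and> t = q"
proof -
  have "a \<le> i" using m[of i] pq by auto
  moreover have "i \<le> a" using m[of a] d pq by auto
  ultimately have ia: "i = a" by simp
  have sp: "s = p"
  proof (rule ccontr)
    assume "s \<noteq> p"
    then consider "s = 2" "p = 1" | "s = 1" "p = 2" using pq by auto
    then show False
    proof cases
      case 1 then show ?thesis using m[of "a + 1"] ia sep by auto
    next
      case 2
      then have j: "j = a + 1" using m[of "a + 1"] ia d by auto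
      then have "t = 2" using m[of b] 2 ia pq by auto
      then show ?thesis using m[of b] m[of "b + 1"] j 2 ia pq sep by auto
    qed
  qed
  have "b \<le> j" using m[of j] d pq ia sp by auto
  moreover have "j \<le> b" using m[of b] pq ia sp by auto
  ultimately have jb: "j = b" by simp
  have "t = q" using m[of "b + 1"] pq ia sp jb d by auto
  with ia sp jb show ?thesis by simp
qed

lemma two_intervals_tiling:
  fixes a b i j p q s t :: nat
  assumes eq: "{i..<i+s} \<union> {j..<j+t} = {a..<a+p} \<union> {b..<b+q}" and disj: "{i..<i+s} \<inter> {j..<j+t} = {}"
    and pq: "p = 1 \<or> p = 2" "q = 1 \<or> q = 2" "s = 1 \<or> s = 2" "t = 1 \<or> t = 2" "a + p \<le> b"
    and sep: "a + p < b \<or> p = 2 \<and> q = 2 \<or> p = 2 \<and> q = 1 \<and> (s = 2 \<longrightarrow> i \<noteq> a + 1) \<and> (t = 2 \<longrightarrow> j \<noteq> a + 1)"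
  shows "(i = a \<and> s = p \<or> i = b \<and> s = q) \<and> (j = a \<and> t = p \<or> j = b \<and> t = q)"
proof -
  have m: "i \<le> z \<and> z < i + s \<or> j \<le> z \<and> z < j + t \<longleftrightarrow> a \<le> z \<and> z < a + p \<or> b \<le> z \<and> z < b + q" for z
    using eq by (metis Un_iff atLeastLessThan_iff)
  then have m': "j \<le> z \<and> z < j + t \<or> i \<le> z \<and> z < i + s \<longleftrightarrow> a \<le> z \<and> z < a + p \<or> b \<le> z \<and> z < b + q" for z
    by (metis disj_commute)
  have "i + s \<le> j \<or> j + t \<le> i"
  proof (rule ccontr)
    assume "\<not> (i + s \<le> j \<or> j + t \<le> i)"
    then have "max i j \<in> {i..<i+s} \<inter> {j..<j+t}" using pq by auto
    then show False using disj by simp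
  qed
  then show ?thesis
  proof
    assume "i + s \<le> j"
    from two_intervals_tiling_less[OF m this pq] sep show ?thesis by blast
  next
    assume "j + t \<le> i"
    from two_intervals_tiling_less[OF m' this pq(1,2,4,3,5)] sep show ?thesis by blast
  qed
qed

text \<open>The exclusion of \<open>Swp (a + 1)\<close> is stated for the operations themselves
  because it will come from legality: equal symbols at \<open>a + 1\<close> and \<open>a + 2\<close>
  cannot be swapped. A single operation is too short to cover both blocks.\<close>

lemma two_ops_tiling:
  assumes "disjoint_ops os" "length os \<le> 2"
    and U: "\<Union>(modified ` set os) = {a..<a+p} \<union> {b..<b+q}"
    and pq: "p = 1 \<or> p = 2" "q = 1 \<or> q = 2" "a + p \<le> b"
    and sep: "a + p < b \<or> p = 2 \<and> q = 2 \<or> p = 2 \<and> q = 1 \<and> Swp (a + 1) \<notin> set os"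
    and x: "x \<in> set os"
  shows "modified x = {a..<a+p} \<or> modified x = {b..<b+q}"
proof -
  consider y where "os = [y]" | y z where "os = [y, z]"
    using assms(2) x by (cases os; cases "tl os") (auto simp: length_Suc_conv)
  then show ?thesis
  proof cases
    case 1
    have m: "{opos y..<opos y + card (modified y)} = {a..<a+p} \<union> {b..<b+q}"
      using U 1 by (subst modified_eq_interval(1)[symmetric]) simp
    have "a \<in> {opos y..<opos y + card (modified y)}" "b + q - 1 \<in> {opos y..<opos y + card (modified y)}"
      unfolding m using pq by auto
    then have "b + q - 1 \<le> a + 1" using modified_eq_interval(2)[of y] by auto
    then have False using pq sep by (elim disjE conjE) simp_all
    then show ?thesis ..
  next
    case 2
    define i s j t where "i = opos y" "s = card (modified y)" "j = opos z" "t = card (modified z)"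
    have yz: "modified y = {i..<i+s}" "modified z = {j..<j+t}" "s = 1 \<or> s = 2" "t = 1 \<or> t = 2"
      unfolding i_s_j_t_def
      by (rule modified_eq_interval(1), rule modified_eq_interval(1), rule modified_eq_interval(2),
          rule modified_eq_interval(2))
    have sw: "s = 2 \<Longrightarrow> y = Swp i" "t = 2 \<Longrightarrow> z = Swp j"
      unfolding i_s_j_t_def by (simp_all only: modified_swap_iff)
    have "(i = a \<and> s = p \<or> i = b \<and> s = q) \<and> (j = a \<and> t = p \<or> j = b \<and> t = q)"
    proof (rule two_intervals_tiling)
      show "{i..<i+s} \<union> {j..<j+t} = {a..<a+p} \<union> {b..<b+q}" using U 2 yz by simp
      show "{i..<i+s} \<inter> {j..<j+t} = {}" using assms(1) 2 yz by simp
      show "a + p < b \<or> p = 2 \<and> q = 2 \<or> p = 2 \<and> q = 1 \<and> (s = 2 \<longrightarrow> i \<noteq> a + 1) \<and> (t = 2 \<longrightarrow> j \<noteq> a + 1)"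
        using sep sw 2 by auto
    qed (use pq yz in auto)
    then show ?thesis using x 2 yz by auto
  qed
qed

text \<open>For \<open>p = 1\<close> the three positions are isolated. For \<open>p = 2\<close> six
  positions covered by at most three operations force every operation to be a swap; the pairs are
  then isolated, or for \<open>k = 2\<close> form one run that is tiled from its ends.\<close>

lemma three_ops_tiling:
  assumes disj: "disjoint_ops os" and len: "length os \<le> 3"
    and U: "\<Union>(modified ` set os) = {d..<d+p} \<union> {d+k..<d+k+p} \<union> {d+2*k..<d+2*k+p}"
    and p: "p = 1 \<and> 2 \<le> k \<or> p = 2 \<and> 2 \<le> k"
    and x: "x \<in> set os"
  shows "modified x = {d..<d+p} \<or> modified x = {d+k..<d+k+p} \<or> modified x = {d+2*k..<d+2*k+p}"
  using p
proof
  assume p: "p = 1 \<and> 2 \<le> k"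
  have "modified x \<subseteq> {d, d + k, d + 2 * k}" using U x p by auto
  then show ?thesis using p by (cases x) auto
next
  assume p: "p = 2 \<and> 2 \<le> k"
  let ?D = "{d..<d+2} \<union> {d+k..<d+k+2} \<union> {d+2*k..<d+2*k+2}"
  have UD: "\<Union>(modified ` set os) = ?D" using U p by simp
  have D: "card ?D = 6"
    using p by (subst card_Un_disjoint; (subst card_Un_disjoint)?) auto
  have swap: "y = Swp (opos y)" if y: "y \<in> set os" for y
  proof (rule ccontr)
    assume "y \<noteq> Swp (opos y)"
    then have 1: "card (modified y) = 1" using modified_swap_iff modified_eq_interval(2) by blast
    have "card (\<Union>(modified ` (set os - {y}))) \<le> (\<Sum>z\<in>set os - {y}. card (modified z))"
      by (rule card_UN_le) simp
    also have "\<dots> \<le> (\<Sum>z\<in>set os - {y}. 2)"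
      by (rule sum_mono) (metis modified_eq_interval(2) one_le_numeral order_refl)
    also have "\<dots> \<le> 4"
      using len card_length[of os] y by (simp add: card_Diff_singleton)
    finally have "card (\<Union>(modified ` (set os - {y}))) \<le> 4" .
    moreover have "\<Union>(modified ` set os) = modified y \<union> \<Union>(modified ` (set os - {y}))"
      using y by auto
    ultimately have "card (\<Union>(modified ` set os)) \<le> 5"
      using 1 card_Un_le[of "modified y" "\<Union>(modified ` (set os - {y}))"] by simp
    then show False using UD D by simp
  qed
  define i where "i = opos x"
  have xi: "modified x = {i, Suc i}" "x = Swp i" using swap[OF x] unfolding i_def by (metis modified.simps(2))+
  have cover: "\<exists>j. Swp j \<in> set os \<and> (z = j \<or> z = Suc j) \<and> j \<in> ?D \<and> Suc j \<in> ?D" if "z \<in> ?D" for z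
  proof -
    have "z \<in> \<Union>(modified ` set os)" using that by (simp only: UD)
    then obtain y where y: "y \<in> set os" "z \<in> modified y" by blast
    then have "modified y \<subseteq> ?D" unfolding UD[symmetric] by blast
    moreover obtain j where "y = Swp j" using swap[OF y(1)] by blast
    ultimately show ?thesis using y by (intro exI[of _ j]) (simp del: Un_iff atLeastLessThan_iff)
  qed
  have clash: "Swp j \<notin> set os" if "j = Suc i \<or> i = Suc j" for j
  proof
    assume "Swp j \<in> set os"
    then have "modified x \<inter> modified (Swp j) = {}" using disjoint_opsD[OF disj x, of "Swp j"] that xi(2) by auto
    then show False using xi that by auto
  qed
  have "i \<in> ?D" "Suc i \<in> ?D" unfolding UD[symmetric] using x xi by blast+
  have "i = d \<or> i = d + k \<or> i = d + 2 * k"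
  proof (cases "k = 2")
    case True
    \<comment> \<open>In the run \<open>d, ..., d + 5\<close> the two extreme positions fix the
      outer swaps, which exclude the odd starting points \<open>d + 1\<close> and
      \<open>d + 3\<close>.\<close>
    have "Swp d \<in> set os" using cover[of d] True by auto
    moreover have "Swp (4 + d) \<in> set os" using cover[of "d + 5"] True by auto
    ultimately have "i \<noteq> d + 1" "i \<noteq> d + 3" using clash by auto
    then show ?thesis using \<open>i \<in> ?D\<close> \<open>Suc i \<in> ?D\<close> True by auto
  next
    case False
    then show ?thesis using \<open>i \<in> ?D\<close> \<open>Suc i \<in> ?D\<close> p by auto
  qed
  then show ?thesis using xi p by auto
qed

section \<open>Overlaps with two clashing blocks\<close>

definition block_op :: "nat \<Rightarrow> nat \<Rightarrow> top" where
  "block_op i p = (if p = 1 then Rep i else Swp i)"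

lemma modified_block_op: "p = 1 \<or> p = 2 \<Longrightarrow> modified (block_op i p) = {i..<i+p}"
  by (auto simp: block_op_def)

lemma op_ok_block_op:
  "p = 1 \<or> p = 2 \<Longrightarrow> op_ok (block_op i p) w \<longleftrightarrow> i + p \<le> length w \<and> (p = 2 \<longrightarrow> w ! i \<noteq> w ! (i + 1))"
  by (auto simp: block_op_def)

text \<open>The second block may extend past the end of the first copy, hence the bound
  \<open>length f + r\<close>. The third alternative of \<open>sep\<close> makes the swap at
  \<open>a + 1\<close> illegal and so removes the rival tiling.\<close>

lemma merge_blocks_not_tilde_isometric:
  assumes pq: "p = 1 \<or> p = 2" "q = 1 \<or> q = 2" "a + p \<le> b" "b + q \<le> length f + r"
    and "0 < r"
    and u: "u = merge f r {a..<a+p} {b..<b+q}"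
    and diff: "\<forall>y\<in>{r..<length f}.
      (f ! y \<noteq> f ! (y - r)) \<longleftrightarrow> (y \<in> {a..<a+p}) \<noteq> (y \<in> {b..<b+q})"
    and swap: "p = 2 \<Longrightarrow> u ! a \<noteq> u ! (a + 1)" "q = 2 \<Longrightarrow> u ! b \<noteq> u ! (b + 1)"
    and sep: "a + p < b \<or> p = 2 \<and> q = 2 \<or> p = 2 \<and> q = 1 \<and> u ! (a + 1) = u ! (a + 2)"
    and free: "free f u" "free f (merge f r {b..<b+q} {a..<a+p})"
  shows "\<not> tilde_isometric f"
proof -
  note mod = modified_block_op[OF pq(1), of a] modified_block_op[OF pq(2), of b]
  show ?thesis
  proof (rule merge_pair_not_tilde_isometric[of r f "block_op a p" "block_op b q"], unfold mod u[symmetric])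
    show "{a..<a+p} \<inter> {b..<b+q} = {}" using pq(3) by auto
    show "op_ok (block_op a p) u"
      using pq swap(1) by (simp add: op_ok_block_op[OF pq(1)] u)
    show "op_ok (block_op b q) u"
      using pq swap(2) by (simp add: op_ok_block_op[OF pq(2)] u)
  next
    fix os x
    assume os: "disjoint_ops os" "\<forall>x\<in>set os. op_ok x u"
      "\<Union>(modified ` set os) = {a..<a+p} \<union> {b..<b+q}" "length os \<le> 2" "x \<in> set os"
    have "Swp (a + 1) \<notin> set os" if "u ! (a + 1) = u ! (a + 2)"
      using os(2) that by auto
    then have "a + p < b \<or> p = 2 \<and> q = 2 \<or> p = 2 \<and> q = 1 \<and> Swp (a + 1) \<notin> set os"
      using sep by blast
    then show "modified x = {a..<a+p} \<or> modified x = {b..<b+q}"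
      using two_ops_tiling[OF os(1,4,3) pq(1-3)] os(5) by blast
  qed (use diff free \<open>0 < r\<close> in blast)+
qed

text \<open>Of the two merged words, the one agreeing with the first copy on the first block is
  always \<open>f\<close>-free. Hence isometry forces an occurrence of \<open>f\<close> in the other
  one, at some offset \<open>k\<close>, and comparing block positions leaves only
  \<open>r = 2 * k\<close>.\<close>

lemma two_block_overlap:
  assumes pq: "p = 1 \<or> p = 2" "q = 1 \<or> q = 2" "r \<le> a" "a + p \<le> b" "b + q \<le> length f"
    and r: "0 < r"
    and diff: "\<forall>y\<in>{r..<length f}.
      (f ! y \<noteq> f ! (y - r)) \<longleftrightarrow> a \<le> y \<and> y < a + p \<or> b \<le> y \<and> y < b + q"
    and swap: "p = 2 \<Longrightarrow> f ! a \<noteq> f ! (a + 1)" "q = 2 \<Longrightarrow> f ! b \<noteq> f ! (b + 1)"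
    and sep: "a + p < b \<or> p = 2 \<and> q = 2 \<or> p = 2 \<and> q = 1 \<and> b = a + 2 \<and> f ! b = f ! a"
    and iso: "tilde_isometric f"
  obtains k where "r = 2 * k" "b = a + k" "p = q"
    "\<And>x. x + k < length f \<Longrightarrow> (f ! x \<noteq> f ! (x + k)) \<longleftrightarrow> a \<le> x + k \<and> x + k < a + p"
proof -
  let ?A = "{a..<a+p}" and ?B = "{b..<b+q}"
  have AB: "\<forall>y\<in>{r..<length f}. (f ! y \<noteq> f ! (y - r)) \<longleftrightarrow> (y \<in> ?A) \<noteq> (y \<in> ?B)"
  proof
    fix y assume "y \<in> {r..<length f}"
    from bspec[OF diff this] pq(4) show "(f ! y \<noteq> f ! (y - r)) \<longleftrightarrow> (y \<in> ?A) \<noteq> (y \<in> ?B)" by auto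
  qed
  then have BA: "\<forall>y\<in>{r..<length f}. (f ! y \<noteq> f ! (y - r)) \<longleftrightarrow> (y \<in> ?B) \<noteq> (y \<in> ?A)"
    by blast
  have ab: "a + p - 1 < length f" "a < length f" "b < length f" "b + q - 1 < length f" "r \<le> b"
    using pq by auto
  have freeBA: "free f (merge f r ?B ?A)"
  proof (rule ccontr)
    assume "\<not> free f (merge f r ?B ?A)"
    then obtain k where k: "k \<le> r"
      and h1: "\<forall>x. x + k < length f \<longrightarrow> (f ! x = f ! (x + k) \<longleftrightarrow> x + k \<notin> ?B)"
      and h3: "\<forall>y. r \<le> y \<and> y < length f \<longrightarrow>
           (((y \<in> ?B) = (y \<in> ?A)) \<longleftrightarrow> ((y + k - r \<in> ?B) = (y + k \<in> ?A)))"
      using occurs_in_merge[OF BA] by blast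
    have "k \<noteq> 0"
    proof
      assume "k = 0" then show False using spec[OF h1, of b] ab pq by auto
    qed
    \<comment> \<open>At the last position of \<open>?A\<close>, moving right by
      \<open>k > 0\<close> leaves \<open>?A\<close>, while moving left by \<open>r - k\<close> stays
      to the left of \<open>?B\<close>; so \<open>h3\<close> fails there.\<close>
    have "a + p - 1 + k \<notin> ?A" "a + p - 1 + k - r \<notin> ?B" "a + p - 1 \<in> ?A" "a + p - 1 \<notin> ?B"
      using \<open>k \<noteq> 0\<close> k pq by auto
    moreover have "r \<le> a + p - 1" using pq by auto
    ultimately show False using spec[OF h3, of "a + p - 1"] ab(1) by blast
  qed
  let ?u = "merge f r ?A ?B"
  have "\<not> free f ?u"
  proof
    assume free: "free f ?u"
    have "\<not> tilde_isometric f"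
    proof (rule merge_blocks_not_tilde_isometric[OF pq(1,2,4) _ r refl AB _ _ _ free freeBA])
      show "?u ! a \<noteq> ?u ! (a + 1)" if "p = 2"
        using swap(1)[OF that] that pq by (simp add: nth_merge_left)
      show "?u ! b \<noteq> ?u ! (b + 1)" if "q = 2"
        using swap(2)[OF that] that pq by (simp add: nth_merge_left)
      \<comment> \<open>For touching blocks of lengths 2 and 1, flipping \<open>?A\<close> turns the
        symbol at \<open>a + 1\<close> into \<open>f ! a\<close>, which equals the symbol at
        \<open>a + 2\<close>.\<close>
      show "a + p < b \<or> p = 2 \<and> q = 2 \<or> p = 2 \<and> q = 1 \<and> ?u ! (a + 1) = ?u ! (a + 2)"
        using sep swap(1) pq by (auto simp: nth_merge_left)
    qed (use pq in auto)
    then show False using iso by simp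
  qed
  then obtain k where k: "k \<le> r"
    and h1: "\<forall>x. x + k < length f \<longrightarrow> (f ! x = f ! (x + k) \<longleftrightarrow> x + k \<notin> ?A)"
    and h2: "\<forall>x. x + (r - k) < length f \<longrightarrow> (f ! x = f ! (x + (r - k)) \<longleftrightarrow> x + r \<notin> ?B)"
    and h3: "\<forall>y. r \<le> y \<and> y < length f \<longrightarrow>
         (((y \<in> ?A) = (y \<in> ?B)) \<longleftrightarrow> ((y + k - r \<in> ?A) = (y + k \<in> ?B)))"
    using occurs_in_merge[OF AB] by blast
  have "k \<noteq> 0"
  proof
    assume "k = 0" then show False using spec[OF h1, of a] ab pq by auto
  qed
  have "k \<noteq> r"
  proof
    assume "k = r" then show False using spec[OF h2, of "b - r"] ab pq by auto
  qed
  have kr: "0 < k" "k < r" using \<open>k \<noteq> 0\<close> \<open>k \<noteq> r\<close> k by auto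
  \<comment> \<open>The facts \<open>y1\<close> to \<open>y4\<close> evaluate \<open>h3\<close> at
    the first and last positions of \<open>?A\<close> and \<open>?B\<close>: a clash there must
    reappear in \<open>?B\<close> after a shift by \<open>k\<close> or in \<open>?A\<close> after a
    shift by \<open>k - r\<close>.\<close>
  have "a \<in> ?A" "a \<notin> ?B" "a + k - r \<notin> ?A" using pq kr by auto
  then have "a + k \<in> ?B" using spec[OF h3, of a] ab(2) pq(3) by blast
  then have y1: "b \<le> a + k \<and> a + k < b + q" by simp
  have y2: "p = 2 \<and> r = k + 1 \<or> b < a + k + p \<and> a + k + p \<le> b + q"
  proof (cases "p = 2 \<and> r \<noteq> k + 1")
    case True
    then have "a + 1 \<in> ?A" "a + 1 \<notin> ?B" "a + 1 + k - r \<notin> ?A" "r \<le> a + 1" "a + 1 < length f"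
      using pq kr ab by auto
    then have "a + 1 + k \<in> ?B" using spec[OF h3, of "a + 1"] by blast
    then show ?thesis using True by simp
  next
    case False
    then show ?thesis using pq(1) y1 by linarith
  qed
  have "b + q - 1 \<notin> ?A" "b + q - 1 \<in> ?B" "b + q - 1 + k \<notin> ?B" "r \<le> b + q - 1"
    using pq kr by auto
  then have "b + q - 1 + k - r \<in> ?A" using spec[OF h3, of "b + q - 1"] ab(4) by blast
  then have y3: "a + r < b + q + k \<and> b + q + k \<le> a + p + r" using pq kr by auto
  have "b \<notin> ?A" "b \<in> ?B" using pq by auto
  then have "b + k - r \<in> ?A \<or> b + k \<in> ?B" using spec[OF h3, of b] ab(3,5) by blast
  then have y4: "a + r \<le> b + k \<and> b + k < a + p + r \<or> q = 2 \<and> k = 1" using pq kr by auto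
  \<comment> \<open>These values are not settled by the block inequalities; they would make
    \<open>f ! a\<close> and \<open>f ! (a + 1)\<close> equal, against the swap.\<close>
  have "r \<noteq> 3 \<or> k \<noteq> 2 \<or> b \<noteq> a + 2 \<or> p \<noteq> 2 \<or> q \<noteq> 1"
  proof (rule ccontr)
    assume "\<not> ?thesis"
    then show False using spec[OF h2, of a] swap(1) ab pq by auto
  qed
  then have r3: "\<not> (r = 3 \<and> k = 2 \<and> b = a + 2 \<and> p = 2 \<and> q = 1)" by blast
  have "r = 2 * k \<and> b = a + k \<and> p = q"
  proof -
    consider "p = 1" "q = 1" | "p = 1" "q = 2" | "p = 2" "q = 1" | "p = 2" "q = 2"
      using pq by blast
    then show ?thesis
    proof cases
      case 1 then show ?thesis using y1 y3 by linarith
    next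
      case 2
      then have "a + 1 < b" using sep by simp
      with 2 y1 y2 y3 y4 kr have False by linarith
      then show ?thesis ..
    next
      case 3
      then have "b = a + k" "r = k + 1" using y1 y2 by linarith+
      moreover from this 3 y4 pq(4) have "b = a + 2" by linarith
      ultimately have False using r3 3 by simp
      then show ?thesis ..
    next
      case 4 then show ?thesis using y1 y2 y3 y4 pq(4) kr by linarith
    qed
  qed
  then show thesis using that[of k] h1 by auto
qed

text \<open>The three blocks flipped here are \<open>d\<close>, \<open>d + k\<close>, \<open>d + 2 k\<close>; the side conditions say that within \<open>f\<close>
  each residue class modulo \<open>k\<close> meeting the defect has exactly two symbols on either side of it.\<close>

lemma three_block_not_tilde_isometric:
  assumes p: "p = 1 \<or> p = 2" and k: "2 \<le> k" "2 * k \<le> d" "d + p \<le> 3 * k"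
    and n: "d + k + p \<le> length f" "length f \<le> d + 2 * k"
    and diff: "\<And>x. x + k < length f \<Longrightarrow> (f ! x \<noteq> f ! (x + k)) \<longleftrightarrow> d \<le> x + k \<and> x + k < d + p"
    and swap: "p = 2 \<Longrightarrow> f ! d \<noteq> f ! (d + 1)"
  shows "\<not> tilde_isometric f"
proof -
  let ?P = "{d..<d+p}" and ?Q = "{d+k..<d+k+p}" and ?R = "{d+2*k..<d+2*k+p}"
  \<comment> \<open>The word \<open>u\<close> differs from the copies of \<open>f\<close> at offsets
    \<open>2 * k\<close>, \<open>0\<close> and \<open>3 * k\<close> exactly on \<open>?P\<close>,
    \<open>?Q\<close> and \<open>?R\<close> respectively.\<close>
  define u where "u = merge f (3 * k) ?Q ?R"
  have pk: "p \<le> k" "0 < p" using p k by auto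
  \<comment> \<open>Of the three steps of length \<open>k\<close> from \<open>y - 3 * k\<close> to
    \<open>y\<close>, the first ends before the defect and the third beyond it; only the middle one
    can clash.\<close>
  have diff3: "(f ! y \<noteq> f ! (y - 3 * k)) \<longleftrightarrow> y \<in> ?Q" if "3 * k \<le> y" "y < length f" for y
  proof -
    define x where "x = y - 3 * k"
    have y: "y = x + k + k + k" using that by (simp add: x_def)
    have "f ! x = f ! (x + k)" using diff[of x] that n y by auto
    moreover have "(f ! (x + k) \<noteq> f ! (x + k + k)) \<longleftrightarrow> y \<in> ?Q"
      using diff[of "x + k"] that y by auto
    moreover have "f ! (x + k + k) = f ! y"
      using diff[of "x + k + k"] that y k by auto
    ultimately show ?thesis by (metis x_def)
  qed
  \<comment> \<open>The outer copies share the positions from \<open>3 * k\<close> up to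
    \<open>length f\<close>. There \<open>?P\<close> is already over and \<open>?R\<close> has not
    begun, so the clash \<open>?Q\<close> can be paired with either; the two pairings describe the
    start and the target word as merges.\<close>
  have QR: "\<forall>y\<in>{3*k..<length f}. (f ! y \<noteq> f ! (y - 3 * k)) \<longleftrightarrow> (y \<in> ?Q) \<noteq> (y \<in> ?R)"
  proof
    fix y assume y: "y \<in> {3*k..<length f}"
    then have y: "3 * k \<le> y" "y < length f" by auto
    then have "y \<notin> ?R" using n by auto
    with diff3[OF y] show "(f ! y \<noteq> f ! (y - 3 * k)) \<longleftrightarrow> (y \<in> ?Q) \<noteq> (y \<in> ?R)" by blast
  qed
  have PQ: "\<forall>y\<in>{3*k..<length f}. (f ! y \<noteq> f ! (y - 3 * k)) \<longleftrightarrow> (y \<in> ?P) \<noteq> (y \<in> ?Q)"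
  proof
    fix y assume y: "y \<in> {3*k..<length f}"
    then have y: "3 * k \<le> y" "y < length f" by auto
    then have "y \<notin> ?P" using k by auto
    with diff3[OF y] show "(f ! y \<noteq> f ! (y - 3 * k)) \<longleftrightarrow> (y \<in> ?P) \<noteq> (y \<in> ?Q)" by blast
  qed
  have flip: "flips (?P \<union> ?Q \<union> ?R) u = merge f (3 * k) ?P ?Q"
  proof (rule nth_equalityI)
    fix x assume "x < length (flips (?P \<union> ?Q \<union> ?R) u)"
    then have x: "x < length f + 3 * k" by (simp add: u_def)
    show "flips (?P \<union> ?Q \<union> ?R) u ! x = merge f (3 * k) ?P ?Q ! x"
    proof (cases "x < length f")
      case True
      then have "x \<notin> ?R" "\<not> (x \<in> ?P \<and> x \<in> ?Q)" using n pk by auto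
      then show ?thesis using True x by (auto simp: u_def merge_def)
    next
      case False
      then have "x \<notin> ?P" "x \<notin> ?Q" using n by auto
      then show ?thesis using False x by (auto simp: u_def merge_def)
    qed
  qed (simp add: u_def)
  have flipP: "\<not> free f (flips ?P u)"
    unfolding not_free_iff
  proof (intro exI[of _ "2 * k"] conjI allI impI)
    fix x assume x: "x < length f"
    show "flips ?P u ! (2 * k + x) = f ! x"
    proof (cases "2 * k + x < length f")
      case True
      have 1: "(f ! x \<noteq> f ! (x + k)) \<longleftrightarrow> 2 * k + x \<in> ?Q" using diff[of x] True by auto
      have 2: "(f ! (x + k) \<noteq> f ! (2 * k + x)) \<longleftrightarrow> 2 * k + x \<in> ?P"
      proof -
        have eq: "x + k + k = 2 * k + x" by simp
        show ?thesis using diff[of "x + k"] True unfolding eq by simp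
      qed
      have "flips ?P u ! (2 * k + x) = ((f ! (2 * k + x) \<noteq> (2 * k + x \<in> ?Q)) \<noteq> (2 * k + x \<in> ?P))"
        using True by (simp add: u_def nth_merge_left)
      then show ?thesis using 1 2 by blast
    next
      case False
      then have kx: "k \<le> x" "2 * k + x \<notin> ?P" using n k by auto
      then have 1: "(f ! (x - k) \<noteq> f ! x) \<longleftrightarrow> 2 * k + x \<in> ?R"
        using diff[of "x - k"] x by auto
      have "2 * k + x - 3 * k = x - k" using kx by simp
      then have "u ! (2 * k + x) = (f ! (x - k) \<noteq> (2 * k + x \<in> ?R))"
        using False x by (simp add: u_def merge_def)
      then have "flips ?P u ! (2 * k + x) = (f ! (x - k) \<noteq> (2 * k + x \<in> ?R))"
        using kx x by (simp add: u_def)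
      then show ?thesis using 1 by blast
    qed
  qed (use n in \<open>simp add: u_def\<close>)
  have dlen: "d < length f" "d + k < length f" using n pk by auto
  have free_u: "free f u"
  proof (rule ccontr)
    assume "\<not> free f u"
    then obtain t where t: "t \<le> 3 * k"
      and h1: "\<forall>x. x + t < length f \<longrightarrow> (f ! x = f ! (x + t) \<longleftrightarrow> x + t \<notin> ?Q)"
      and h2: "\<forall>x. x + (3 * k - t) < length f \<longrightarrow> (f ! x = f ! (x + (3 * k - t)) \<longleftrightarrow> x + 3 * k \<notin> ?R)"
      and h3: "\<forall>y. 3 * k \<le> y \<and> y < length f \<longrightarrow>
           (((y \<in> ?Q) = (y \<in> ?R)) \<longleftrightarrow> ((y + t - 3 * k \<in> ?Q) = (y + t \<in> ?R)))"
      using occurs_in_merge[OF QR] unfolding u_def by blast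
    have "t \<noteq> 3 * k"
    proof
      assume "t = 3 * k"
      then show False using spec[OF h2, of "d - k"] dlen k p by auto
    qed
    have "t \<noteq> k"
    proof
      assume t: "t = k"
      then have "f ! (d - k) = f ! d" using spec[OF h1, of "d - k"] dlen k by auto
      then show False using diff[of "d - k"] dlen k pk by auto
    qed
    \<comment> \<open>The first position of \<open>?Q\<close> leaves only \<open>t = k\<close>,
      excluded by the defect at \<open>d\<close>, or \<open>t = k + 1\<close> with
      \<open>p = 2\<close>, excluded by the next position.\<close>
    have "d + k \<in> ?Q" "d + k \<notin> ?R" "d + k + t - 3 * k \<notin> ?Q" "3 * k \<le> d + k"
      using k pk t \<open>t \<noteq> 3 * k\<close> by auto
    then have "d + k + t \<in> ?R" using spec[OF h3, of "d + k"] dlen by blast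
    then have tp: "t = k + 1" "p = 2" using \<open>t \<noteq> k\<close> p by auto
    then have "d + k + 1 \<in> ?Q" "d + k + 1 \<notin> ?R" "d + k + 1 + t - 3 * k \<notin> ?Q" "3 * k \<le> d + k + 1"
      "d + k + 1 + t \<notin> ?R" "d + k + 1 < length f"
      using k n by auto
    then show False using spec[OF h3, of "d + k + 1"] by blast
  qed
  have free_v: "free f (merge f (3 * k) ?P ?Q)"
  proof (rule ccontr)
    assume "\<not> free f (merge f (3 * k) ?P ?Q)"
    then obtain t where t: "t \<le> 3 * k"
      and h1: "\<forall>x. x + t < length f \<longrightarrow> (f ! x = f ! (x + t) \<longleftrightarrow> x + t \<notin> ?P)"
      and h2: "\<forall>x. x + (3 * k - t) < length f \<longrightarrow> (f ! x = f ! (x + (3 * k - t)) \<longleftrightarrow> x + 3 * k \<notin> ?Q)"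
      and h3: "\<forall>y. 3 * k \<le> y \<and> y < length f \<longrightarrow>
           (((y \<in> ?P) = (y \<in> ?Q)) \<longleftrightarrow> ((y + t - 3 * k \<in> ?P) = (y + t \<in> ?Q)))"
      using occurs_in_merge[OF PQ] by blast
    have "t \<noteq> 0"
    proof
      assume "t = 0"
      then show False using spec[OF h1, of d] dlen pk by auto
    qed
    have "t \<noteq> 2 * k"
    proof
      assume t: "t = 2 * k"
      then have "f ! (d - k) = f ! d" using spec[OF h2, of "d - k"] dlen k pk by auto
      then show False using diff[of "d - k"] dlen k pk by auto
    qed
    have "d + k \<notin> ?P" "d + k \<in> ?Q" "3 * k \<le> d + k" using k pk by auto
    then have "d + k + t - 3 * k \<in> ?P \<or> d + k + t \<in> ?Q" using spec[OF h3, of "d + k"] dlen by blast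
    then have tp: "p = 2" "t = 2 * k + 1 \<or> t = 1" using \<open>t \<noteq> 0\<close> \<open>t \<noteq> 2 * k\<close> p k by auto
    then have "d + k + 1 \<notin> ?P" "d + k + 1 \<in> ?Q" "d + k + 1 + t - 3 * k \<notin> ?P" "3 * k \<le> d + k + 1"
      "d + k + 1 + t \<notin> ?Q" "d + k + 1 < length f"
      using k n by auto
    then show False using spec[OF h3, of "d + k + 1"] by blast
  qed
  let ?os = "[block_op d p, block_op (d + k) p, block_op (d + 2 * k) p]"
  have mod: "modified (block_op i p) = {i..<i+p}" for i by (rule modified_block_op[OF p])
  have len_u: "length u = length f + 3 * k" by (simp add: u_def)
  have ok: "\<forall>a\<in>set ?os. op_ok a u"
  proof -
    have "u ! d \<noteq> u ! (d + 1) \<and> u ! (d + k) \<noteq> u ! (d + k + 1) \<and> u ! (d + 2 * k) \<noteq> u ! (d + 2 * k + 1)"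
      if p2: "p = 2"
    proof (intro conjI)
      show "u ! d \<noteq> u ! (d + 1)" using swap p2 k n by (simp add: u_def nth_merge_left)
      have "f ! (d + k) = f ! d" "f ! (d + 1 + k) = f ! (d + 1)"
        using diff[of d] diff[of "d + 1"] n p2 k by auto
      then show "u ! (d + k) \<noteq> u ! (d + k + 1)" using swap p2 k n by (simp add: u_def nth_merge_left)
      have "f ! (d - k) \<noteq> f ! d" "f ! (d + 1 - k) \<noteq> f ! (d + 1)"
        using diff[of "d - k"] diff[of "d + 1 - k"] n p2 k by auto
      moreover have "d + 2 * k - 3 * k = d - k" "d + 2 * k + 1 - 3 * k = d + 1 - k" using k by auto
      ultimately show "u ! (d + 2 * k) \<noteq> u ! (d + 2 * k + 1)"
        using swap p2 k n by (simp add: u_def merge_def)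
    qed
    then show ?thesis using n k by (simp add: op_ok_block_op[OF p] len_u)
  qed
  show ?thesis
  proof (rule not_tilde_isometricI[where u = u and D = "?P \<union> ?Q \<union> ?R" and ts = ?os])
    show "free f (flips (?P \<union> ?Q \<union> ?R) u)" unfolding flip by (rule free_v)
    show "length f < length u" using k by (simp add: len_u)
    show "?P \<union> ?Q \<union> ?R \<noteq> {}" using pk by simp
    show "disjoint_ops ?os" using pk by (auto simp: mod)
    show "\<Union>(modified ` set ?os) = ?P \<union> ?Q \<union> ?R" by (simp add: mod Un_assoc)
  next
    fix os a
    assume os: "disjoint_ops os" "\<Union>(modified ` set os) = ?P \<union> ?Q \<union> ?R"
      "length os \<le> length ?os" "a \<in> set os"
    then have "modified a = ?P \<or> modified a = ?Q \<or> modified a = ?R"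
      using three_ops_tiling[of os d p k a] p k by simp
    then show "\<not> free f (flips (modified a) u)"
      using flipP not_free_flips_merge_left[of f ?Q "3 * k" ?R]
        not_free_flips_merge_right[OF QR] unfolding u_def by metis
  qed (fact free_u ok)+
qed

section \<open>Conditions (3), (4) and (5)\<close>

text \<open>The triple is read as a swap followed by a replacement. The exceptional case of
  \<open>two_block_overlap\<close> requires blocks of equal length, so it cannot arise.\<close>

lemma alternating_triple_overlap:
  assumes "r \<le> a" "a + 3 \<le> length f" "0 < r"
    and diff: "\<forall>y\<in>{r..<length f}. (f ! y \<noteq> f ! (y - r)) \<longleftrightarrow> a \<le> y \<and> y < a + 3"
    and "f ! a \<noteq> f ! (a + 1)" "f ! (a + 2) = f ! a"
  shows "\<not> tilde_isometric f"
proof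
  assume iso: "tilde_isometric f"
  have "\<forall>y\<in>{r..<length f}. (f ! y \<noteq> f ! (y - r)) \<longleftrightarrow> a \<le> y \<and> y < a + 2 \<or> a + 2 \<le> y \<and> y < a + 2 + 1"
  proof
    fix y assume "y \<in> {r..<length f}"
    from bspec[OF diff this]
    show "(f ! y \<noteq> f ! (y - r)) \<longleftrightarrow> a \<le> y \<and> y < a + 2 \<or> a + 2 \<le> y \<and> y < a + 2 + 1" by auto
  qed
  from two_block_overlap[of 2 1 r a "a + 2" f, OF _ _ _ _ _ _ this _ _ _ iso] show False
    using assms by auto
qed

text \<open>With the second copy at offset \<open>length w1\<close>, its 101 lies over the 010 of
  the first copy, between the common parts \<open>w2\<close> and \<open>w3\<close>.\<close>

lemma cond3_not_tilde_isometric: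
  assumes "cond3 f"
  shows "\<not> tilde_isometric f"
proof -
  obtain w1 w2 w3 w4 where w: "w1 \<noteq> []" and f1: "f = w2 @ [True, False, True] @ w3 @ w4"
    and f2: "f = w1 @ w2 @ [False, True, False] @ w3"
    using assms unfolding cond3_def by blast
  have len: "length f = length w1 + length w2 + 3 + length w3" by (simp add: f2)
  have nth1: "f ! x = (w2 @ [True, False, True] @ w3) ! x" if "x < length w2 + 3 + length w3" for x
  proof -
    have "f = (w2 @ [True, False, True] @ w3) @ w4" by (simp add: f1)
    moreover have "x < length (w2 @ [True, False, True] @ w3)" using that by simp
    ultimately show ?thesis using nth_append[of "w2 @ [True, False, True] @ w3" w4 x] by metis
  qed
  have nth2: "f ! (length w1 + x) = (w2 @ [False, True, False] @ w3) ! x" for x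
    by (simp add: f2)
  have mid: "\<not> f ! (length w1 + length w2)" "f ! (length w1 + length w2 + 1)" "\<not> f ! (length w1 + length w2 + 2)"
    by (simp_all add: f2 nth_append)
  show ?thesis
  proof (rule alternating_triple_overlap[where r = "length w1" and a = "length w1 + length w2"])
    show "\<forall>y\<in>{length w1..<length f}. (f ! y \<noteq> f ! (y - length w1)) \<longleftrightarrow>
        length w1 + length w2 \<le> y \<and> y < length w1 + length w2 + 3"
    proof
      fix y assume yr: "y \<in> {length w1..<length f}"
      define x where "x = y - length w1"
      have y: "y = length w1 + x" and x: "x < length w2 + 3 + length w3"
        using yr len by (auto simp: x_def)
      have "(w2 @ [False, True, False] @ w3) ! x \<noteq> (w2 @ [True, False, True] @ w3) ! x
          \<longleftrightarrow> length w2 \<le> x \<and> x < length w2 + 3"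
        by (auto simp: nth_append nth_Cons')
      then show "(f ! y \<noteq> f ! (y - length w1)) \<longleftrightarrow>
        length w1 + length w2 \<le> y \<and> y < length w1 + length w2 + 3"
        using nth1[OF x] nth2[of x] y by simp
    qed
  qed (use w len mid in auto)
qed

text \<open>The ending 011 of the first copy meets 100 of the second, and the fourth symbol 1 of the
  second lies just past the first. On these four positions \<open>u\<close> has 1010: swapping its
  first pair gives 0110, restoring the first copy, and swapping its second pair gives 1001,
  restoring the second.\<close>

lemma cond4_not_tilde_isometric:
  assumes "cond4 f"
  shows "\<not> tilde_isometric f"
proof -
  obtain x0 y0 z0 where f1: "f = x0 @ [True, False, False, True] @ z0"
    and f2: "f = y0 @ x0 @ [False, True, True]"
    using assms unfolding cond4_def by blast
  define r a where "r = length y0" and "a = length y0 + length x0"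
  have n: "length f = a + 3" using f2 by (simp add: a_def)
  have ra: "r \<le> a" by (simp add: r_def a_def)
  have r: "0 < r"
  proof (rule ccontr)
    assume "\<not> 0 < r"
    then have "f = x0 @ [False, True, True]" using f2 by (simp add: r_def)
    then show False using f1 by simp
  qed
  have end_f: "\<not> f ! a" "f ! (a + 1)" "f ! (a + 2)"
    by (simp_all add: f2 a_def nth_append)
  have beg_f: "f ! (a - r)" "\<not> f ! (a + 1 - r)" "\<not> f ! (a + 2 - r)" "f ! (a + 3 - r)"
    by (simp_all add: f1 a_def r_def nth_append)
  let ?A = "{a..<a+2}" and ?B = "{a+2..<a+2+2}"
  have AB: "\<forall>y\<in>{r..<length f}. (f ! y \<noteq> f ! (y - r)) \<longleftrightarrow> (y \<in> ?A) \<noteq> (y \<in> ?B)"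
  proof
    fix y assume y: "y \<in> {r..<length f}"
    consider "y < a" | "y = a" | "y = a + 1" | "y = a + 2" using y n by force
    then show "(f ! y \<noteq> f ! (y - r)) \<longleftrightarrow> (y \<in> ?A) \<noteq> (y \<in> ?B)"
    proof cases
      case 1
      have "y - r < length x0" "\<not> y < length y0" using 1 y by (auto simp: r_def a_def)
      then have "f ! y = x0 ! (y - r)" using f2 by (simp add: nth_append r_def)
      moreover have "f ! (y - r) = x0 ! (y - r)"
        using f1 \<open>y - r < length x0\<close> by (simp add: nth_append)
      ultimately show ?thesis using 1 by simp
    qed (use end_f beg_f in auto)
  qed
  then have BA: "\<forall>y\<in>{r..<length f}. (f ! y \<noteq> f ! (y - r)) \<longleftrightarrow> (y \<in> ?B) \<noteq> (y \<in> ?A)"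
    by blast
  have freeBA: "free f (merge f r ?B ?A)"
  proof (rule ccontr)
    assume "\<not> free f (merge f r ?B ?A)"
    then obtain k where k: "k \<le> r"
      and h1: "\<forall>x. x + k < length f \<longrightarrow> (f ! x = f ! (x + k) \<longleftrightarrow> x + k \<notin> ?B)"
      and h3: "\<forall>y. r \<le> y \<and> y < length f \<longrightarrow>
           (((y \<in> ?B) = (y \<in> ?A)) \<longleftrightarrow> ((y + k - r \<in> ?B) = (y + k \<in> ?A)))"
      using occurs_in_merge[OF BA] by blast
    have "k \<noteq> 0"
    proof
      assume "k = 0" then show False using spec[OF h1, of "a + 2"] n by auto
    qed
    then have "a + 1 + k \<notin> ?A" "a + 1 + k - r \<notin> ?B" "a + 1 \<in> ?A" "a + 1 \<notin> ?B" "r \<le> a + 1" "a + 1 < length f"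
      using k ra n by auto
    then show False using spec[OF h3, of "a + 1"] by blast
  qed
  have freeAB: "free f (merge f r ?A ?B)"
  proof (rule ccontr)
    assume "\<not> free f (merge f r ?A ?B)"
    then obtain k where k: "k \<le> r"
      and h1: "\<forall>x. x + k < length f \<longrightarrow> (f ! x = f ! (x + k) \<longleftrightarrow> x + k \<notin> ?A)"
      and h2: "\<forall>x. x + (r - k) < length f \<longrightarrow> (f ! x = f ! (x + (r - k)) \<longleftrightarrow> x + r \<notin> ?B)"
      and h3: "\<forall>y. r \<le> y \<and> y < length f \<longrightarrow>
           (((y \<in> ?A) = (y \<in> ?B)) \<longleftrightarrow> ((y + k - r \<in> ?A) = (y + k \<in> ?B)))"
      using occurs_in_merge[OF AB] by blast
    have "k \<noteq> r"
    proof
      assume "k = r" then show False using spec[OF h2, of "a + 2 - r"] n ra by auto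
    qed
    then have "a \<in> ?A" "a \<notin> ?B" "a + k - r \<notin> ?A" "a < length f" using k ra n by auto
    then have "a + k \<in> ?B" using spec[OF h3, of a] ra by blast
    moreover have "k \<noteq> 2"
    proof
      assume "k = 2" then show False using spec[OF h1, of a] end_f n by auto
    qed
    ultimately have k3: "k = 3" by auto
    then have "a + 1 \<in> ?A" "a + 1 \<notin> ?B" "a + 1 + k \<notin> ?B" "r \<le> a + 1" "a + 1 < length f" using ra n by auto
    then have "a + 1 + k - r \<in> ?A" using spec[OF h3, of "a + 1"] by blast
    then have r4: "r = 4" using ra k3 k \<open>k \<noteq> r\<close> by auto
    have "a = 4"
    proof (rule ccontr)
      assume "a \<noteq> 4"
      then have "a - 1 \<notin> ?A" "a - 1 \<notin> ?B" "a - 1 + k - r \<notin> ?A" "a - 1 + k \<in> ?B" "r \<le> a - 1" "a - 1 < length f"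
        using ra r4 k3 n by auto
      then show False using spec[OF h3, of "a - 1"] by blast
    qed
    \<comment> \<open>The values \<open>k = 3\<close> and \<open>r = a = 4\<close> satisfy every
      condition on positions. They fail on symbols: \<open>f ! 1\<close> and \<open>f ! 4\<close>
      are both 0 although 4 lies in \<open>?A\<close>.\<close>
    then show False using spec[OF h1, of 1] k3 r4 beg_f end_f n by auto
  qed
  let ?u = "merge f r ?A ?B"
  have u: "?u ! a" "\<not> ?u ! (a + 1)" "?u ! (a + 2)" "\<not> ?u ! (a + 3)"
    using end_f beg_f n by (auto simp: merge_def r)
  show ?thesis
    by (rule merge_blocks_not_tilde_isometric[OF _ _ _ _ r refl AB _ _ _ freeAB freeBA])
      (use u n r in \<open>auto simp: numeral_eq_Suc\<close>)
qed

text \<open>The copies share two positions, where 00 meets 11. The first swap begins one place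
  before the second copy and the second ends one place after the first copy. On the four positions
  \<open>u\<close> has 0101, and the two swaps give 1001 and 0110, which contain the required 100
  and 110.\<close>

lemma cond5_not_tilde_isometric:
  assumes "cond5 f"
  shows "\<not> tilde_isometric f"
proof -
  obtain p0 s0 where f1: "f = [True, True, False] @ p0" and f2: "f = s0 @ [True, False, False]"
    using assms unfolding cond5_def by blast
  define a where "a = length s0"
  have n: "length f = a + 3" using f2 by (simp add: a_def)
  have beg_f: "f ! 0" "f ! 1" "\<not> f ! 2" by (simp_all add: f1)
  have end_f: "f ! a" "\<not> f ! (a + 1)" "\<not> f ! (a + 2)" by (simp_all add: f2 a_def nth_append)
  have a: "1 \<le> a" using beg_f end_f by (cases a) auto
  let ?r = "a + 1" and ?A = "{a..<a+2}" and ?B = "{a+2..<a+2+2}"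
  have AB: "\<forall>y\<in>{?r..<length f}. (f ! y \<noteq> f ! (y - ?r)) \<longleftrightarrow> (y \<in> ?A) \<noteq> (y \<in> ?B)"
  proof
    fix y assume y: "y \<in> {?r..<length f}"
    then have "y = a + 1 \<or> y = a + 2" using n by auto
    then show "(f ! y \<noteq> f ! (y - ?r)) \<longleftrightarrow> (y \<in> ?A) \<noteq> (y \<in> ?B)"
      using beg_f end_f by auto
  qed
  then have BA: "\<forall>y\<in>{?r..<length f}. (f ! y \<noteq> f ! (y - ?r)) \<longleftrightarrow> (y \<in> ?B) \<noteq> (y \<in> ?A)"
    by blast
  have freeBA: "free f (merge f ?r ?B ?A)"
  proof (rule ccontr)
    assume "\<not> free f (merge f ?r ?B ?A)"
    then obtain k where k: "k \<le> ?r"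
      and h1: "\<forall>x. x + k < length f \<longrightarrow> (f ! x = f ! (x + k) \<longleftrightarrow> x + k \<notin> ?B)"
      and h3: "\<forall>y. ?r \<le> y \<and> y < length f \<longrightarrow>
           (((y \<in> ?B) = (y \<in> ?A)) \<longleftrightarrow> ((y + k - ?r \<in> ?B) = (y + k \<in> ?A)))"
      using occurs_in_merge[OF BA] by blast
    have "k \<noteq> 0"
    proof
      assume "k = 0" then show False using spec[OF h1, of "a + 2"] n by auto
    qed
    then have "a + 1 + k \<notin> ?A" "a + 1 + k - ?r \<notin> ?B" "a + 1 \<in> ?A" "a + 1 \<notin> ?B" "?r \<le> a + 1" "a + 1 < length f"
      using k n by auto
    then show False using spec[OF h3, of "a + 1"] by blast
  qed
  have freeAB: "free f (merge f ?r ?A ?B)"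
  proof (rule ccontr)
    assume "\<not> free f (merge f ?r ?A ?B)"
    then obtain k where k: "k \<le> ?r"
      and h1: "\<forall>x. x + k < length f \<longrightarrow> (f ! x = f ! (x + k) \<longleftrightarrow> x + k \<notin> ?A)"
      and h2: "\<forall>x. x + (?r - k) < length f \<longrightarrow> (f ! x = f ! (x + (?r - k)) \<longleftrightarrow> x + ?r \<notin> ?B)"
      and h3: "\<forall>y. ?r \<le> y \<and> y < length f \<longrightarrow>
           (((y \<in> ?A) = (y \<in> ?B)) \<longleftrightarrow> ((y + k - ?r \<in> ?A) = (y + k \<in> ?B)))"
      using occurs_in_merge[OF AB] by blast
    have "k \<noteq> ?r"
    proof
      assume "k = ?r" then show False using spec[OF h2, of 1] n by auto
    qed
    then have ka: "k \<le> a" using k by simp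
    have "a + 1 \<in> ?A" "a + 1 \<notin> ?B" "?r \<le> a + 1" "a + 1 < length f" "a + 1 + k - ?r = k" using n by auto
    then have y1: "(k \<in> ?A) \<noteq> (a + 1 + k \<in> ?B)" using spec[OF h3, of "a + 1"] by metis
    have "a + 2 \<in> ?B" "a + 2 \<notin> ?A" "?r \<le> a + 2" "a + 2 < length f" "a + 2 + k - ?r = k + 1" using n by auto
    then have y2: "(k + 1 \<in> ?A) \<noteq> (a + 2 + k \<in> ?B)" using spec[OF h3, of "a + 2"] by metis
    \<comment> \<open>Small shifts compare known symbols at the beginning 110. For
      \<open>k \<ge> 3\<close> the positions force \<open>k = a\<close>, and the remaining shift
      \<open>?r - k = 1\<close> compares the unequal symbols at \<open>a\<close> and
      \<open>a + 1\<close>.\<close>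
    consider "k = 0" | "k = 1" | "k = 2" | "3 \<le> k" by linarith
    then show False
    proof cases
      case 1 then show ?thesis using spec[OF h1, of a] n by auto
    next
      case 2
      have "f ! 1 = f ! (1 + k) \<longleftrightarrow> 1 + k \<notin> ?A" using spec[OF h1, of 1] 2 n by auto
      then have "2 \<in> ?A" using beg_f 2 by (simp add: numeral_2_eq_2)
      then have "a = 1 \<or> a = 2" using a by auto
      moreover have "f ! 0 = f ! k \<longleftrightarrow> k \<notin> ?A" using spec[OF h1, of 0] 2 n by auto
      ultimately show ?thesis using beg_f 2 y2 by auto
    next
      case 3
      have "f ! 0 = f ! k \<longleftrightarrow> k \<notin> ?A" using spec[OF h1, of 0] ka n by simp
      then have "k \<in> ?A" using beg_f 3 by auto
      then show ?thesis using y1 3 ka by auto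
    next
      case 4
      then have "k = a" using y1 ka by auto
      then have "f ! a = f ! (a + 1) \<longleftrightarrow> a + ?r \<notin> ?B" using spec[OF h2, of a] n by simp
      then have "a + ?r \<in> ?B" using end_f by blast
      then show ?thesis using 4 \<open>k = a\<close> by auto
    qed
  qed
  let ?u = "merge f ?r ?A ?B"
  have u: "\<not> ?u ! a" "?u ! (a + 1)" "\<not> ?u ! (a + 2)" "?u ! (a + 3)"
    using end_f beg_f n by (auto simp: merge_def)
  show ?thesis
    by (rule merge_blocks_not_tilde_isometric[OF _ _ _ _ _ refl AB _ _ _ freeAB freeBA])
      (use u n a in \<open>auto simp: numeral_eq_Suc\<close>)
qed

section \<open>Words that are periodic up to one block\<close>

text \<open>A shift by \<open>m * k\<close> is a chain of \<open>m\<close> shifts by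
  \<open>k\<close>. Since \<open>p \<le> k\<close>, the translates of the block are disjoint, so at
  most one link of the chain clashes and no clashes cancel.\<close>

lemma iterated_period_errors:
  assumes diff: "\<And>x. x + k < length f \<Longrightarrow> (f ! x \<noteq> f ! (x + k)) \<longleftrightarrow> e \<le> x \<and> x < e + p"
    and "p \<le> k" and "m * k \<le> y" "y < length f"
  shows "(f ! y \<noteq> f ! (y - m * k)) \<longleftrightarrow> (\<exists>g. 1 \<le> g \<and> g \<le> m \<and> e + g * k \<le> y \<and> y < e + g * k + p)"
  using assms(3)
proof (induction m)
  case (Suc m)
  define x where "x = y - Suc m * k"
  have y: "y = x + k + m * k" "y - m * k = x + k" "m * k \<le> y" using Suc.prems by (auto simp: x_def)
  have last: "(f ! x \<noteq> f ! (x + k)) \<longleftrightarrow> e + Suc m * k \<le> y \<and> y < e + Suc m * k + p"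
    using diff[of x] y assms(4) by auto
  have IH: "(f ! y \<noteq> f ! (x + k)) \<longleftrightarrow> (\<exists>g. 1 \<le> g \<and> g \<le> m \<and> e + g * k \<le> y \<and> y < e + g * k + p)"
    using Suc.IH y by simp
  have excl: False if "1 \<le> g" "g \<le> m" "y < e + g * k + p" "e + Suc m * k \<le> y" for g
  proof -
    have "g * k + k \<le> Suc m * k" using that mult_le_mono1[of "g + 1" "Suc m" k] by simp
    then show False using that assms(2) by linarith
  qed
  have "(f ! y \<noteq> f ! x) \<longleftrightarrow> (\<exists>g. 1 \<le> g \<and> g \<le> Suc m \<and> e + g * k \<le> y \<and> y < e + g * k + p)"
    (is "_ = ?E")
  proof (cases "f ! x \<noteq> f ! (x + k)")
    case True
    then have E: ?E using last by (intro exI[of _ "Suc m"]) simp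
    have "f ! y = f ! (x + k)" using IH excl last True by blast
    then have "f ! y \<noteq> f ! x" using True by simp
    with E show ?thesis by blast
  next
    case False
    then have "?E \<longleftrightarrow> (\<exists>g. 1 \<le> g \<and> g \<le> m \<and> e + g * k \<le> y \<and> y < e + g * k + p)"
      using last le_Suc_eq by metis
    then show ?thesis using IH False by metis
  qed
  then show ?case by (simp only: x_def)
qed simp

text \<open>\<open>M\<close> places the translates with index at most \<open>j - 2\<close> before
  the common part, and \<open>n\<close> places those with index above \<open>j\<close> past the end
  of \<open>f\<close>; only the last two remain visible.\<close>

lemma iterated_period_window:
  assumes diff: "\<And>x. x + k < length f \<Longrightarrow> (f ! x \<noteq> f ! (x + k)) \<longleftrightarrow> e \<le> x \<and> x < e + p"
    and "p \<le> k" and y: "m * k \<le> y" "y < length f"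
    and j: "2 \<le> j" "j \<le> m" and n: "length f \<le> e + j * k + k" and M: "e + (j - 1) * k + p \<le> m * k + k"
  shows "(f ! y \<noteq> f ! (y - m * k)) \<longleftrightarrow>
    e + (j - 1) * k \<le> y \<and> y < e + (j - 1) * k + p \<or> e + (j - 1) * k + k \<le> y \<and> y < e + (j - 1) * k + k + p"
proof -
  have jk: "j * k = (j - 1) * k + k" using j by (cases j) auto
  have "g = j - 1 \<or> g = j" if g: "e + g * k \<le> y" "y < e + g * k + p" for g
  proof (rule ccontr)
    assume "\<not> (g = j - 1 \<or> g = j)"
    then consider "g + 2 \<le> j" | "j + 1 \<le> g" using j by linarith
    then show False
    proof cases
      case 1
      then have "g * k + 2 * k \<le> j * k" using mult_le_mono1[of "g + 2" j k] by (simp add: algebra_simps)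
      then show ?thesis using g y M jk by linarith
    next
      case 2
      then have "j * k + k \<le> g * k" using mult_le_mono1[of "j + 1" g k] by simp
      then show ?thesis using g y n by linarith
    qed
  qed
  moreover have "1 \<le> j - 1" "j - 1 \<le> m" "1 \<le> j" using j by auto
  ultimately have "(\<exists>g. 1 \<le> g \<and> g \<le> m \<and> e + g * k \<le> y \<and> y < e + g * k + p) \<longleftrightarrow>
    e + (j - 1) * k \<le> y \<and> y < e + (j - 1) * k + p \<or> e + j * k \<le> y \<and> y < e + j * k + p"
    using j(2) by blast
  then show ?thesis using iterated_period_errors[OF diff assms(2) y] jk by (simp add: add.assoc)
qed

text \<open>Take the largest multiple of \<open>k\<close> for which two blocks still clash. Truncation at the ends of \<open>f\<close> may
  shorten a swap block to a replacement, which accounts for the mixed types below.\<close>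

lemma one_block_period_not_tilde_isometric:
  assumes p: "p = 1 \<or> p = 2" and k: "p < k" "k \<le> e" "e + 2 * k + p \<le> length f"
    and diff: "\<And>x. x + k < length f \<Longrightarrow> (f ! x \<noteq> f ! (x + k)) \<longleftrightarrow> e \<le> x \<and> x < e + p"
    and swap: "p = 2 \<Longrightarrow> f ! e \<noteq> f ! (e + 1)"
  shows "\<not> tilde_isometric f"
proof
  assume iso: "tilde_isometric f"
  \<comment> \<open>Here \<open>i\<close> and \<open>s\<close> locate the block within its period,
    and \<open>j\<close> is the largest index for which the translate \<open>e + j * k\<close> still
    starts inside \<open>f\<close>.\<close>
  define i s j where "i = e div k" and "s = e mod k" and "j = (length f - 1 - e) div k"
  have k0: "0 < k" "0 < p" using k p by auto
  have s: "s < k" "e = i * k + s" using k0 by (auto simp: i_def s_def)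
  have i: "1 \<le> i" using k k0 by (simp add: i_def div_greater_zero_iff Suc_le_eq)
  have j2: "2 \<le> j" using k k0 p by (auto simp: j_def less_eq_div_iff_mult_less_eq)
  have "j * k \<le> length f - 1 - e" "length f - 1 - e < j * k + k"
    using k0 by (auto simp: j_def) (metis add.commute div_mult_mod_eq mod_less_divisor nat_add_left_cancel_less)
  then have jn: "e + j * k < length f" "length f \<le> e + j * k + k" using k by auto
  define \<alpha> where "\<alpha> = e + (j - 1) * k"
  have \<alpha>k: "\<alpha> + k = e + j * k" using j2 by (cases j) (auto simp: \<alpha>_def)
  have pk: "p \<le> k" using k by simp
  \<comment> \<open>Both symbols of each later translate are the complements of those of the block
    at \<open>e\<close>, so they still differ.\<close>
  have alt: "f ! (e + g * k) \<noteq> f ! (e + g * k + 1)" if g: "e + g * k + 1 < length f" and p2: "p = 2" for g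
  proof (cases "g = 0")
    case True then show ?thesis using swap p2 by simp
  next
    case False
    have "f ! (e + g * k + z) \<noteq> f ! (e + z)" if "z < 2" "e + g * k + z < length f" for z
    proof -
      have "\<exists>h. 1 \<le> h \<and> h \<le> g \<and> e + h * k \<le> e + g * k + z \<and> e + g * k + z < e + h * k + p"
        using False p2 that by (intro exI[of _ g]) auto
      moreover have "e + g * k + z - g * k = e + z" by simp
      ultimately show ?thesis
        using iterated_period_errors[of k f e p g "e + g * k + z", OF diff] that pk by simp
    qed
    from this[of 0] this[of 1] show ?thesis using swap[OF p2] g by auto
  qed
  have alt1: "f ! \<alpha> \<noteq> f ! (\<alpha> + 1)" if "p = 2" "\<alpha> + 1 < length f"
    using alt[of "j - 1"] that by (simp add: \<alpha>_def)
  have alt2: "f ! (\<alpha> + k) \<noteq> f ! (\<alpha> + k + 1)" if "p = 2" "\<alpha> + k + 1 < length f"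
    using alt[of j] that by (simp add: \<alpha>k)
  show False
  proof (cases "s + p \<le> k")
    case sp: True
    \<comment> \<open>This is the largest shift whose common part still contains the whole translate
      at \<open>\<alpha>\<close>: it begins \<open>s\<close> positions before
      \<open>\<alpha>\<close>.\<close>
    define m where "m = i + j - 1"
    have m: "j \<le> m" "2 \<le> m" using i j2 by (auto simp: m_def)
    have M: "m * k + s = \<alpha>"
    proof -
      have "m = i + (j - 1)" using j2 by (simp add: m_def)
      then show ?thesis using s by (simp add: \<alpha>_def add_mult_distrib)
    qed
    have err: "(f ! y \<noteq> f ! (y - m * k)) \<longleftrightarrow> \<alpha> \<le> y \<and> y < \<alpha> + p \<or> \<alpha> + k \<le> y \<and> y < \<alpha> + k + p"
      if "m * k \<le> y" "y < length f" for y
      using iterated_period_window[of k f e p m y j, OF diff pk that j2 m(1) jn(2)] M sp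
      unfolding \<alpha>_def by simp
    show False
    proof (cases "\<alpha> + k + p \<le> length f")
      case True
      have D: "\<forall>y\<in>{m * k..<length f}. (f ! y \<noteq> f ! (y - m * k)) \<longleftrightarrow>
          \<alpha> \<le> y \<and> y < \<alpha> + p \<or> \<alpha> + k \<le> y \<and> y < \<alpha> + k + p"
        using err by simp
      obtain k' where "m * k = 2 * k'" "\<alpha> + k = \<alpha> + k'"
        using two_block_overlap[of p p "m * k" \<alpha> "\<alpha> + k" f, OF p p _ _ _ _ D _ _ _ iso]
          True M k k0 m alt1 alt2 by auto
      then have "m = 2" using k0 by simp
      \<comment> \<open>The exceptional case leaves only the shift \<open>2 * k\<close>; the bounds
        are now those of the three-block construction with \<open>d = e + k\<close>.\<close>
      then have "i = 1" "j = 2" using i j2 by (auto simp: m_def)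
      then have "e + k + p \<le> 3 * k" "length f \<le> e + k + 2 * k" using s sp jn by auto
      moreover have "(f ! x \<noteq> f ! (x + k)) \<longleftrightarrow> e + k \<le> x + k \<and> x + k < e + k + p" if "x + k < length f" for x
        using diff[OF that] by auto
      moreover have "f ! (e + k) \<noteq> f ! (e + k + 1)" if "p = 2" using alt[of 1] that k by simp
      ultimately have "\<not> tilde_isometric f"
        using three_block_not_tilde_isometric[of p k "e + k" f] p k by auto
      then show False using iso by simp
    next
      case False
      \<comment> \<open>The end of \<open>f\<close> cuts the last swap block to one position;
        unequal block lengths exclude the exceptional case.\<close>
      then have p2: "p = 2" "length f = \<alpha> + k + 1" using jn \<alpha>k p by auto
      have D: "\<forall>y\<in>{m * k..<length f}. (f ! y \<noteq> f ! (y - m * k)) \<longleftrightarrow>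
          \<alpha> \<le> y \<and> y < \<alpha> + 2 \<or> \<alpha> + k \<le> y \<and> y < \<alpha> + k + 1"
        using err p2 by auto
      show False
        using two_block_overlap[of 2 1 "m * k" \<alpha> "\<alpha> + k" f, OF _ _ _ _ _ _ D _ _ _ iso]
          M k k0 m alt1 p2 by auto
    qed
  next
    case False
    then have p2: "p = 2" and sk: "s + 1 = k" using s p by auto
    \<comment> \<open>The block now straddles a multiple of \<open>k\<close>. The common part starts
      at \<open>\<alpha> + 1\<close>, so only the second position of the translate at
      \<open>\<alpha>\<close> survives.\<close>
    define m where "m = i + j"
    have m: "j \<le> m" "3 \<le> m" using i j2 by (auto simp: m_def)
    have M: "m * k = \<alpha> + 1"
    proof -
      have "m * k = i * k + j * k" by (simp add: m_def add_mult_distrib)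
      then show ?thesis using s(2) sk \<alpha>k by linarith
    qed
    have err: "(f ! y \<noteq> f ! (y - m * k)) \<longleftrightarrow> y = \<alpha> + 1 \<or> \<alpha> + k \<le> y \<and> y < \<alpha> + k + 2"
      if "m * k \<le> y" "y < length f" for y
      using iterated_period_window[of k f e p m y j, OF diff pk that j2 m(1) jn(2)] M p2 k that
      unfolding \<alpha>_def[symmetric] by auto
    show False
    proof (cases "\<alpha> + k + 2 \<le> length f")
      case True
      have D: "\<forall>y\<in>{m * k..<length f}. (f ! y \<noteq> f ! (y - m * k)) \<longleftrightarrow>
          \<alpha> + 1 \<le> y \<and> y < \<alpha> + 1 + 1 \<or> \<alpha> + k \<le> y \<and> y < \<alpha> + k + 2"
        using err by auto
      show False
        using two_block_overlap[of 1 2 "m * k" "\<alpha> + 1" "\<alpha> + k" f, OF _ _ _ _ _ _ D _ _ _ iso]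
          True M k p2 alt2 by auto
    next
      case False
      then have n: "length f = \<alpha> + k + 1" using jn \<alpha>k by simp
      have D: "\<forall>y\<in>{m * k..<length f}. (f ! y \<noteq> f ! (y - m * k)) \<longleftrightarrow>
          \<alpha> + 1 \<le> y \<and> y < \<alpha> + 1 + 1 \<or> \<alpha> + k \<le> y \<and> y < \<alpha> + k + 1"
        using err n by auto
      obtain k' where k': "m * k = 2 * k'" "\<alpha> + k = \<alpha> + 1 + k'"
        using two_block_overlap[of 1 1 "m * k" "\<alpha> + 1" "\<alpha> + k" f, OF _ _ _ _ _ _ D _ _ _ iso]
          n M k p2 by auto
      \<comment> \<open>The exceptional case would need \<open>m * k = 2 * (k - 1)\<close>, below
        this bound.\<close>
      moreover have "3 * k \<le> m * k" using m by simp
      ultimately show False using k0 by linarith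
    qed
  qed
qed

text \<open>For \<open>p = k = 2\<close> the translates abut, so \<open>f\<close> alternates from
  \<open>e + 2\<close> on, and an even shift leaving at most four common positions makes all of them
  clash. The parity of \<open>length f\<close> decides between four positions, read as two swaps,
  and three, an alternating triple.\<close>

lemma alternating_with_defect_not_tilde_isometric:
  assumes e: "2 \<le> e" "e + 6 \<le> length f"
    and diff: "\<And>x. x + 2 < length f \<Longrightarrow> (f ! x \<noteq> f ! (x + 2)) \<longleftrightarrow> e \<le> x \<and> x < e + 2"
    and swap: "f ! e \<noteq> f ! (e + 1)"
  shows "\<not> tilde_isometric f"
proof
  assume iso: "tilde_isometric f"
  have alt: "f ! z \<noteq> f ! (z + 1)" if "e + 2 \<le> z" "z + 1 < length f" for z
    using that
  proof (induction z rule: less_induct)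
    case (less z)
    have e2: "f ! (e + 2) \<noteq> f ! (e + 3)"
      using diff[of e] diff[of "e + 1"] swap e by (auto simp: numeral_eq_Suc)
    consider "z = e + 2" | "z = e + 3" | "e + 4 \<le> z" using less.prems by linarith
    then show ?case
    proof cases
      case 1
      then have eq: "z + 1 = e + 3" by simp
      show ?thesis unfolding eq using e2 1 by simp
    next
      case 2
      have "f ! (e + 2) = f ! (e + 4)" using diff[of "e + 2"] e by (auto simp: numeral_eq_Suc)
      moreover have eq: "z + 1 = e + 4" using 2 by simp
      ultimately show ?thesis unfolding eq using e2 2 by simp
    next
      case 3
      define x where "x = z - 2"
      have x: "z = x + 2" "z + 1 = x + 1 + 2" "e + 2 \<le> x" using 3 by (auto simp: x_def)
      have "f ! x \<noteq> f ! (x + 1)" using less.IH[of x] x less.prems by simp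
      moreover have "f ! x = f ! z" using diff[of x] x less.prems by simp
      moreover have "f ! (x + 1) = f ! (z + 1)" using diff[of "x + 1"] x less.prems by simp
      ultimately show ?thesis by simp
    qed
  qed
  have err: "f ! y \<noteq> f ! (y - m * 2)"
    if y: "m * 2 \<le> y" "y < length f" "length f \<le> m * 2 + 4" for m y
  proof -
    have "\<exists>g. 1 \<le> g \<and> g \<le> m \<and> e + g * 2 \<le> y \<and> y < e + g * 2 + 2"
      using e y by (intro exI[of _ "(y - e) div 2"]) auto
    then show ?thesis using iterated_period_errors[of 2 f e 2 m y, OF diff] y by simp
  qed
  show False
  proof (cases "even (length f)")
    case True
    then obtain m' where m': "length f = 2 * m'" by (rule evenE)
    define m where "m = m' - 2"
    have n: "length f = m * 2 + 4" using m' e by (simp add: m_def)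
    have D: "\<forall>y\<in>{m * 2..<length f}. (f ! y \<noteq> f ! (y - m * 2)) \<longleftrightarrow>
        m * 2 \<le> y \<and> y < m * 2 + 2 \<or> m * 2 + 2 \<le> y \<and> y < m * 2 + 2 + 2"
    proof
      fix y assume y: "y \<in> {m * 2..<length f}"
      then have "m * 2 \<le> y \<and> y < m * 2 + 2 \<or> m * 2 + 2 \<le> y \<and> y < m * 2 + 2 + 2" using n by auto
      moreover have "f ! y \<noteq> f ! (y - m * 2)" using err[of m y] y n by simp
      ultimately show "(f ! y \<noteq> f ! (y - m * 2)) \<longleftrightarrow>
        m * 2 \<le> y \<and> y < m * 2 + 2 \<or> m * 2 + 2 \<le> y \<and> y < m * 2 + 2 + 2" by blast
    qed
    obtain k where "m * 2 = 2 * k" "m * 2 + 2 = m * 2 + k"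
      using two_block_overlap[of 2 2 "m * 2" "m * 2" "m * 2 + 2" f, OF _ _ _ _ _ _ D _ _ _ iso]
        n e alt[of "m * 2"] alt[of "m * 2 + 2"] by auto
    \<comment> \<open>The exceptional case fixes the length at 8, where the three-block construction
      with \<open>d = 4\<close> applies.\<close>
    then have n8: "length f = 8" "e = 2" using n e by auto
    have "(f ! x \<noteq> f ! (x + 2)) \<longleftrightarrow> 4 \<le> x + 2 \<and> x + 2 < 4 + 2" if "x + 2 < length f" for x
      using diff[OF that] n8 by auto
    then have "\<not> tilde_isometric f"
      using three_block_not_tilde_isometric[of 2 2 4 f] n8 alt[of 4] by simp
    then show False using iso by simp
  next
    case False
    then obtain m' where m': "length f = 2 * m' + 1" by (rule oddE)
    define m where "m = m' - 1"
    have n: "length f = m * 2 + 3" using m' e by (simp add: m_def)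
    have D: "\<forall>y\<in>{m * 2..<length f}. (f ! y \<noteq> f ! (y - m * 2)) \<longleftrightarrow> m * 2 \<le> y \<and> y < m * 2 + 3"
      using err[of m] n by simp
    have "f ! (m * 2) \<noteq> f ! (m * 2 + 1)" "f ! (m * 2 + 1) \<noteq> f ! (m * 2 + 2)"
      using alt[of "m * 2"] alt[of "m * 2 + 1"] n e by (auto simp: numeral_eq_Suc)
    then have "\<not> tilde_isometric f"
      using alternating_triple_overlap[OF _ _ _ D] n e by auto
    then show False using iso by simp
  qed
qed

section \<open>Overlaps whose errors are separated or both swaps\<close>

lemma two_block_overlap_not_tilde_isometric:
  assumes pq: "p = 1 \<or> p = 2" "q = 1 \<or> q = 2" "r \<le> a" "a + p \<le> b" "b + q \<le> length f"
    and r: "0 < r"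
    and diff: "\<forall>y\<in>{r..<length f}.
      (f ! y \<noteq> f ! (y - r)) \<longleftrightarrow> a \<le> y \<and> y < a + p \<or> b \<le> y \<and> y < b + q"
    and swap: "p = 2 \<Longrightarrow> f ! a \<noteq> f ! (a + 1)" "q = 2 \<Longrightarrow> f ! b \<noteq> f ! (b + 1)"
    and sep: "a + p < b \<or> p = 2 \<and> q = 2"
  shows "\<not> tilde_isometric f"
proof
  assume iso: "tilde_isometric f"
  have sep': "a + p < b \<or> p = 2 \<and> q = 2 \<or> p = 2 \<and> q = 1 \<and> b = a + 2 \<and> f ! b = f ! a" using sep by blast
  obtain k where k: "r = 2 * k" "b = a + k" "p = q"
    and K: "\<And>x. x + k < length f \<Longrightarrow> (f ! x \<noteq> f ! (x + k)) \<longleftrightarrow> a \<le> x + k \<and> x + k < a + p"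
    using two_block_overlap[OF pq r diff swap sep' iso] by blast
  \<comment> \<open>The defect is re-indexed by the left end of the compared pair. As
    \<open>a \<ge> 2 * k\<close>, it satisfies \<open>k \<le> e\<close>; and \<open>sep\<close>
    gives \<open>p < k\<close> or \<open>p = k = 2\<close>.\<close>
  define e where "e = a - k"
  have ae: "a = e + k" "k \<le> e" using k pq by (auto simp: e_def)
  have E: "(f ! x \<noteq> f ! (x + k)) \<longleftrightarrow> e \<le> x \<and> x < e + p" if "x + k < length f" for x
    using K[OF that] ae by auto
  have S: "f ! e \<noteq> f ! (e + 1)" if "p = 2"
  proof -
    have "f ! e \<noteq> f ! a" "f ! (e + 1) \<noteq> f ! (a + 1)"
      using E[of e] E[of "e + 1"] that ae pq by auto
    then show ?thesis using swap(1)[OF that] by simp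
  qed
  have "\<not> tilde_isometric f"
  proof (cases "p < k")
    case True
    then show ?thesis using one_block_period_not_tilde_isometric[OF pq(1) _ _ _ E S] ae k pq by auto
  next
    case False
    then have "p = 2" "k = 2" using sep k pq by auto
    then show ?thesis
      using alternating_with_defect_not_tilde_isometric[of e f] E S ae k pq by auto
  qed
  then show False using iso by simp
qed

text \<open>Error positions are counted within the prefix, blocks within the first copy of
  \<open>f\<close>, which meets the second at offset \<open>r = length f - l\<close>; hence the
  translation by \<open>r\<close>. Both symbols under a swap are flipped, so they also differ in the
  suffix.\<close>

lemma err_overlap_ops_blocks:
  assumes "err_overlap_ops f l oa ob"
  shows "\<exists>r a p b q. (p = 1 \<or> p = 2) \<and> (q = 1 \<or> q = 2) \<and> r \<le> a \<and> a + p \<le> b \<and> b + q \<le> length f \<and> 0 < r \<and>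
    (\<forall>y\<in>{r..<length f}. (f ! y \<noteq> f ! (y - r)) \<longleftrightarrow> a \<le> y \<and> y < a + p \<or> b \<le> y \<and> y < b + q) \<and>
    (p = 2 \<longrightarrow> f ! a \<noteq> f ! (a + 1)) \<and> (q = 2 \<longrightarrow> f ! b \<noteq> f ! (b + 1)) \<and>
    (p = 2 \<longleftrightarrow> is_swap oa) \<and> (q = 2 \<longleftrightarrow> is_swap ob) \<and> (adjacent oa ob \<longleftrightarrow> a + p = b)"
proof -
  have l: "1 \<le> l" "l \<le> length f - 1" and less: "opos oa < opos ob"
    using assms by (auto simp: err_overlap_ops_def two_err_overlap_def)
  obtain os where os: "os = [oa, ob] \<or> os = [ob, oa]" and mt: "minimal_trans (pre l f) os (suf l f)"
    using assms unfolding err_overlap_ops_def by blast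
  define r where "r = length f - l"
  have r: "0 < r" "l + r = length f" using l by (auto simp: r_def)
  have len: "length (pre l f) = l" using l by (simp add: pre_def)
  have dis: "disjoint_ops os" by (rule minimal_trans_disjoint_ops[OF mt])
  have val: "ops_valid (pre l f) os" "last (trace (pre l f) os) = suf l f"
    using mt by (auto simp: minimal_trans_def transforms_def)
  have ok: "op_ok oa (pre l f)" "op_ok ob (pre l f)"
    using val(1) os ops_valid_disjoint_ops[OF dis] by auto
  have disj: "modified oa \<inter> modified ob = {}" using dis os by auto
  have eq: "suf l f = flips (modified oa \<union> modified ob) (pre l f)"
    using last_trace_disjoint_ops[OF dis val(1)] val(2) os by (auto simp: Un_commute)
  have nth: "f ! (x + r) = (f ! x \<noteq> (x \<in> modified oa \<union> modified ob))" if "x < l" for x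
  proof -
    have "suf l f ! x = f ! (x + r)" using that r l by (simp add: suf_def r_def add.commute)
    moreover have "pre l f ! x = f ! x" using that by (simp add: pre_def)
    ultimately show ?thesis using eq that len by simp
  qed
  define i p j q where "i = opos oa" "p = card (modified oa)" "j = opos ob" "q = card (modified ob)"
  have A: "modified oa = {i..<i+p}" and B: "modified ob = {j..<j+q}"
    and pq: "p = 1 \<or> p = 2" "q = 1 \<or> q = 2"
    unfolding i_p_j_q_def
    by (rule modified_eq_interval(1), rule modified_eq_interval(1), rule modified_eq_interval(2),
          rule modified_eq_interval(2))
  have ij: "i < j" using less by (simp add: i_p_j_q_def)
  have ipj: "i + p \<le> j"
  proof (rule ccontr)
    assume "\<not> i + p \<le> j"
    then have "j \<in> {i..<i+p} \<inter> {j..<j+q}" using ij pq by auto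
    then show False using disj A B by simp
  qed
  have "{i..<i+p} \<subseteq> {..<l}" "{j..<j+q} \<subseteq> {..<l}"
    using modified_subset[OF ok(1)] modified_subset[OF ok(2)] A B len by simp_all
  then have "j + q - 1 \<in> {..<l}" using pq by (auto simp: subset_eq)
  then have jq: "j + q \<le> l" using pq by auto
  have flip: "f ! (x + r) = (f ! x \<noteq> (i \<le> x \<and> x < i + p \<or> j \<le> x \<and> x < j + q))" if "x < l" for x
    using nth[OF that] A B by simp
  have sw: "p = 2 \<longleftrightarrow> is_swap oa" "q = 2 \<longleftrightarrow> is_swap ob"
    by (cases oa; cases ob; simp add: i_p_j_q_def)+
  have swa: "f ! i \<noteq> f ! (i + 1)" if "p = 2"
    using ok(1) that len ipj jq by (cases oa) (auto simp: i_p_j_q_def pre_def)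
  have swb: "f ! j \<noteq> f ! (j + 1)" if "q = 2"
    using ok(2) that len jq by (cases ob) (auto simp: i_p_j_q_def pre_def)
  have adj: "adjacent oa ob \<longleftrightarrow> r + i + p = r + j"
    by (cases oa) (auto simp: i_p_j_q_def)
  have D: "\<forall>y\<in>{r..<length f}. (f ! y \<noteq> f ! (y - r)) \<longleftrightarrow>
      r + i \<le> y \<and> y < r + i + p \<or> r + j \<le> y \<and> y < r + j + q"
  proof
    fix y assume y: "y \<in> {r..<length f}"
    define x where "x = y - r"
    have x: "y = x + r" "x < l" using y r by (auto simp: x_def)
    show "(f ! y \<noteq> f ! (y - r)) \<longleftrightarrow> r + i \<le> y \<and> y < r + i + p \<or> r + j \<le> y \<and> y < r + j + q"
      using flip[OF x(2)] x(1) by auto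
  qed
  have sa: "f ! (r + i) \<noteq> f ! (r + i + 1)" if "p = 2"
    using flip[of i] flip[of "i + 1"] swa that ipj jq pq by (auto simp: add_ac)
  have sb: "f ! (r + j) \<noteq> f ! (r + j + 1)" if "q = 2"
    using flip[of j] flip[of "j + 1"] swb that ipj jq pq by (auto simp: add_ac)
  show ?thesis
    by (rule exI[of _ r], rule exI[of _ "r + i"], rule exI[of _ p], rule exI[of _ "r + j"], rule exI[of _ q])
      (use pq ipj jq r D sa sb sw adj in simp)
qed

lemma err_overlap_ops_not_tilde_isometric:
  assumes "err_overlap_ops f l oa ob" "\<not> adjacent oa ob \<or> is_swap oa \<and> is_swap ob"
  shows "\<not> tilde_isometric f"
proof -
  obtain r a p b q where B: "p = 1 \<or> p = 2" "q = 1 \<or> q = 2" "r \<le> a" "a + p \<le> b" "b + q \<le> length f" "0 < r"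
    "\<forall>y\<in>{r..<length f}. (f ! y \<noteq> f ! (y - r)) \<longleftrightarrow> a \<le> y \<and> y < a + p \<or> b \<le> y \<and> y < b + q"
    and swap: "p = 2 \<longrightarrow> f ! a \<noteq> f ! (a + 1)" "q = 2 \<longrightarrow> f ! b \<noteq> f ! (b + 1)"
    and types: "p = 2 \<longleftrightarrow> is_swap oa" "q = 2 \<longleftrightarrow> is_swap ob" "adjacent oa ob \<longleftrightarrow> a + p = b"
    using err_overlap_ops_blocks[OF assms(1)] by (elim exE conjE) (rule that)
  have "a + p < b \<or> p = 2 \<and> q = 2" using assms(2) types B(4) by linarith
  then show ?thesis
    using two_block_overlap_not_tilde_isometric[OF B] swap by blast
qed

section \<open>Reversal and complement\<close>

lemma length_apply_op [simp]: "length (apply_op a w) = length w"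
  by (cases a) auto

lemma ops_valid_modified_subset:
  "ops_valid w os \<Longrightarrow> a \<in> set os \<Longrightarrow> modified a \<subseteq> {..<length w}"
  by (induction os arbitrary: w) (use modified_subset in fastforce)+

text \<open>A common frame for reversal and complement: \<open>\<phi>\<close> acts on words and
  \<open>\<psi>\<close> on operations, the latter depending on the word length because mirrored
  positions do.\<close>

lemma tilde_isometric_involution:
  assumes len: "\<And>w. length (\<phi> w) = length w" and inv: "\<And>w. \<phi> (\<phi> w) = w"
    and ok: "\<And>a w. op_ok a w \<Longrightarrow> op_ok (\<psi> (length w) a) (\<phi> w)"
    and app: "\<And>a w. op_ok a w \<Longrightarrow> apply_op (\<psi> (length w) a) (\<phi> w) = \<phi> (apply_op a w)"
    and dis: "\<And>L a b. modified a \<subseteq> {..<L} \<Longrightarrow> modified b \<subseteq> {..<L} \<Longrightarrow> modified a \<inter> modified b = {} \<Longrightarrow>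
      modified (\<psi> L a) \<inter> modified (\<psi> L b) = {}"
    and free: "\<And>f w. free f w \<Longrightarrow> free (\<phi> f) (\<phi> w)"
    and iso: "tilde_isometric f"
  shows "tilde_isometric (\<phi> f)"
proof -
  have tr: "ops_valid (\<phi> u) (map (\<psi> L) os) \<and> trace (\<phi> u) (map (\<psi> L) os) = map \<phi> (trace u os)"
    if "ops_valid u os" "length u = L" for u os L
    using that
  proof (induction os arbitrary: u)
    case (Cons a os)
    then show ?case using ok[of a u] app[of a u] by auto
  qed simp
  have tf: "transforms (\<phi> u) (map (\<psi> (length u)) os) (\<phi> v)" if "transforms u os v" for u os v
    using tr[of u os] that by (auto simp: transforms_def last_map)
  \<comment> \<open>Transporting back from \<open>\<phi> u\<close> and \<open>\<phi> v\<close>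
    returns to \<open>u\<close> and \<open>v\<close>, so the distances agree.\<close>
  have "(\<exists>os. transforms (\<phi> u) os (\<phi> v) \<and> length os = n) \<longleftrightarrow> (\<exists>os. transforms u os v \<and> length os = n)" for u v n
    using tf[of u _ v] tf[of "\<phi> u" _ "\<phi> v"] inv by (metis length_map)
  then have td: "tdist (\<phi> u) (\<phi> v) = tdist u v" for u v by (simp add: tdist_def)
  show ?thesis
    unfolding tilde_isometric_def
  proof (intro allI impI)
    fix m u v
    assume m: "length (\<phi> f) < m" and uv: "length u = m \<and> length v = m \<and> free (\<phi> f) u \<and> free (\<phi> f) v"
    have "free f (\<phi> u)" "free f (\<phi> v)" using uv free[of "\<phi> f"] inv by metis+
    then obtain os where os: "minimal_trans (\<phi> u) os (\<phi> v)" "\<forall>x\<in>set (trace (\<phi> u) os). free f x"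
      using iso m uv len unfolding tilde_isometric_def by metis
    let ?os = "map (\<psi> m) os"
    have os': "transforms (\<phi> u) os (\<phi> v)" "ops_valid (\<phi> u) os" "length os = tdist u v"
      using os(1) td by (auto simp: minimal_trans_def transforms_def)
    have "transforms u ?os v" using tf[OF os'(1)] inv len uv by simp
    moreover have "modified (?os ! a) \<inter> modified (?os ! b) = {}"
      if ab: "a < length ?os" "b < length ?os" "a \<noteq> b" for a b
    proof -
      have "modified (os ! a) \<inter> modified (os ! b) = {}" using os(1) ab by (simp add: minimal_trans_def)
      moreover have "modified (os ! c) \<subseteq> {..<m}" if "c < length os" for c
        using ops_valid_modified_subset[OF os'(2)] that len uv by (metis nth_mem)
      ultimately show ?thesis using dis ab by simp
    qed
    ultimately have "minimal_trans u ?os v" using os'(3) by (simp add: minimal_trans_def)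
    moreover have "trace u ?os = map \<phi> (trace (\<phi> u) os)"
      using tr[OF os'(2), of m] inv len uv by simp
    then have "\<forall>x\<in>set (trace u ?os). free (\<phi> f) x" using os(2) free by auto
    ultimately show "\<exists>ops. minimal_trans u ops v \<and> (\<forall>x\<in>set (trace u ops). free (\<phi> f) x)" by blast
  qed
qed

text \<open>A swap is named by its left position, so the mirror image is named by the image of the
  right one, \<open>Suc i\<close>.\<close>

fun mirror_op :: "nat \<Rightarrow> top \<Rightarrow> top" where
  "mirror_op L (Rep i) = Rep (L - Suc i)"
| "mirror_op L (Swp i) = Swp (L - Suc (Suc i))"

lemma mirror_op_rev:
  assumes "op_ok a w"
  shows "op_ok (mirror_op (length w) a) (rev w)"
    and "apply_op (mirror_op (length w) a) (rev w) = rev (apply_op a w)"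
proof -
  have "op_ok (mirror_op (length w) a) (rev w) \<and>
    apply_op (mirror_op (length w) a) (rev w) = rev (apply_op a w)"
  proof (cases a)
    case (Rep i)
    then show ?thesis using assms by (simp add: rev_nth rev_update)
  next
    case (Swp i)
    define i' where "i' = length w - Suc (Suc i)"
    have i: "Suc i < length w" "w ! i \<noteq> w ! Suc i" using assms Swp by auto
    then have i': "Suc i' = length w - Suc i" "Suc i' < length w" by (auto simp: i'_def)
    have nth: "rev w ! i' = w ! Suc i" "rev w ! Suc i' = w ! i"
      using i i' by (auto simp: rev_nth i'_def)
    have "rev (apply_op a w) = (rev w)[Suc i' := w ! Suc i, i' := w ! i]"
      using i i'(1) by (simp add: Swp rev_update i'_def)
    also have "\<dots> = apply_op (Swp i') (rev w)"
      using nth list_update_swap[of "Suc i'" i' "rev w"] by simp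
    finally show ?thesis using i' nth i Swp by (simp add: i'_def[symmetric])
  qed
  then show "op_ok (mirror_op (length w) a) (rev w)"
    "apply_op (mirror_op (length w) a) (rev w) = rev (apply_op a w)" by blast+
qed

lemma tilde_isometric_rev: "tilde_isometric f \<Longrightarrow> tilde_isometric (rev f)"
proof (rule tilde_isometric_involution[where \<phi> = rev and \<psi> = mirror_op])
  \<comment> \<open>The bounds by \<open>L\<close> matter: subtraction on naturals truncates, and
    mirroring is injective only on positions below \<open>L\<close>.\<close>
  show "modified (mirror_op L a) \<inter> modified (mirror_op L b) = {}"
    if "modified a \<subseteq> {..<L}" "modified b \<subseteq> {..<L}" "modified a \<inter> modified b = {}" for L a b
    using that by (cases a; cases b) auto
  show "free (rev f) (rev w)" if "free f w" for f w :: "bool list"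
    unfolding free_def
  proof
    assume "\<exists>p s. rev w = p @ rev f @ s"
    then obtain p s where "rev w = p @ rev f @ s" by blast
    then have "w = rev s @ f @ rev p" by (metis append.assoc rev_append rev_rev_ident)
    then show False using that by (auto simp: free_def)
  qed
qed (simp_all add: mirror_op_rev)

lemma tilde_isometric_map_Not: "tilde_isometric f \<Longrightarrow> tilde_isometric (map Not f)"
proof (rule tilde_isometric_involution[where \<phi> = "map Not" and \<psi> = "\<lambda>_ a. a"])
  show "op_ok a (map Not w)" if "op_ok a w" for a w
    using that by (cases a) auto
  show "apply_op a (map Not w) = map Not (apply_op a w)" if "op_ok a w" for a w
    using that by (cases a) (auto simp: map_update)
  show "free (map Not f) (map Not w)" if "free f w" for f w
    unfolding free_def
  proof
    have NN: "map Not (map Not z) = z" for z by (simp add: comp_def)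
    assume "\<exists>p s. map Not w = p @ map Not f @ s"
    then obtain p s where "map Not w = p @ map Not f @ s" by blast
    then have "w = map Not p @ f @ map Not s" by (metis NN map_append)
    then show False using that by (auto simp: free_def)
  qed
qed (simp_all add: comp_def)

theorem theorem1:
  fixes f :: "bool list"
  assumes "\<exists>g \<in> {f, rev f, map Not f, rev (map Not f)}.
             cond1 g \<or> cond2 g \<or> cond3 g \<or> cond4 g \<or> cond5 g"
  shows "\<not> tilde_isometric f"
proof
  assume "tilde_isometric f"
  then have "\<forall>g \<in> {f, rev f, map Not f, rev (map Not f)}. tilde_isometric g"
    using tilde_isometric_rev tilde_isometric_map_Not by simp
  with assms show False
    using err_overlap_ops_not_tilde_isometric cond3_not_tilde_isometric
      cond4_not_tilde_isometric cond5_not_tilde_isometric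
    unfolding cond1_def cond2_def by metis
qed

end
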